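(* Let $O\mapsto\mathcal A(O)\subset B(\mathcal H)$ be a Haag--Kastler net of von Neumann algebras and let $O$ be a double cone. The following are equivalent. (i) $\mathcal A$ satisfies Haag duality at $O$, i.e. $\mathcal A(O)=\mathcal A(O')'$. (ii) Every normal unital completely positive map on $B(\mathcal H)$ fixing $\mathcal A(O')$ pointwise is $\mathcal A(O)$-inner. (iii) $\mathfrak{NS}_{\mathcal A}(O)=\operatorname{Chan}(\mathcal A(O))$. If Haag duality fails at $O$, then for every bounded self-adjoint $a\in\mathcal A^d(O)\setminus\mathcal A(O)$ there is $\delta>0$ such that $$\alpha_t:=\operatorname{Ad}_{e^{ita}}\in\mathfrak{NS}_{\mathcal A}(O)\setminus\operatorname{Chan}(\mathcal A(O))\qquad\text{for all }0<|t|<\delta,$$ while $\|\alpha_t-\mathrm{id}\|_{\mathrm{cb}}\to0$ as $t\to0$.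
   Context: Net: $O\mapsto\mathcal A(O)\subset B(\mathcal H)$ assigns to each (bounded open) double cone $O$ in Minkowski space a von Neumann algebra on the Hilbert space $\mathcal H$, with isotony ($O_1\subset O_2\Rightarrow\mathcal A(O_1)\subset\mathcal A(O_2)$) and locality ($[\mathcal A(O_1),\mathcal A(O_2)]=0$ whenever $O_1\subset O_2'$, where $O'$ is the causal complement of $O$). For a general open region $R$, $\mathcal A(R):=\bigvee_{V\subset R}\mathcal A(V)$, the von Neumann algebra generated by all $\mathcal A(V)$ with $V\subset R$ a double cone. The dual net is $\mathcal A^d(O):=\mathcal A(O')'$ (commutant); locality gives $\mathcal A(O)\subset\mathcal A^d(O)$. $\mathfrak{NS}_{\mathcal A}(O)$ is the class of normal unital completely positive maps $\Phi:B(\mathcal H)\to B(\mathcal H)$ with $\Phi(y)=y$ for all $y\in\mathcal A(O')$. For a von Neumann algebra $M\subset B(\mathcal H)$, $\operatorname{Chan}(M)$ is the class of normal unital completely positive maps $\Phi$ on $B(\mathcal H)$ admitting a representation $\Phi(x)=\sum_{i\in I}k_i^*xk_i$ with an arbitrary index set $I$, $k_i\in M$ and $\sum_i k_i^*k_i=1$ (sums are ultraweak limits of nets of finite partial sums). Such channels are called $M$-inner. $\operatorname{Ad}_u(x)=u^*xu$; $\|\cdot\|_{\mathrm{cb}}$ is the completely bounded norm of maps on $B(\mathcal H)$. *)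

theory Defs
  imports "HOL-Analysis.Analysis"
begin

section \<open>Complex Hilbert spaces\<close>

class scaleC =
  fixes scaleC :: "complex \<Rightarrow> 'a \<Rightarrow> 'a"  (infixr \<open>*\<^sub>C\<close> 75)

class complex_vector = real_vector + scaleC +
  assumes scaleC_add_right: "c *\<^sub>C (x + y) = c *\<^sub>C x + c *\<^sub>C y"
    and scaleC_add_left: "(c + d) *\<^sub>C x = c *\<^sub>C x + d *\<^sub>C x"
    and scaleC_scaleC: "c *\<^sub>C d *\<^sub>C x = (c * d) *\<^sub>C x"
    and scaleR_scaleC: "r *\<^sub>R x = complex_of_real r *\<^sub>C x"

text \<open>The inner product is linear in the second argument. Completeness comes from
  class \<^class>\<open>banach\<close>; positive definiteness follows from the last axiom, since
  \<^const>\<open>sqrt\<close> is negative on negative numbers. Neither separability nor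
  nontriviality is assumed.\<close>

class complex_hilbert = complex_vector + banach +
  fixes cinner :: "'a \<Rightarrow> 'a \<Rightarrow> complex"
  assumes cinner_commute: "cinner x y = cnj (cinner y x)"
    and cinner_add_right: "cinner x (y + z) = cinner x y + cinner x z"
    and cinner_scaleC_right: "cinner x (c *\<^sub>C y) = c * cinner x y"
    and norm_eq_sqrt_cinner: "norm x = sqrt (Re (cinner x x))"

lemma cinner_add_left:
  "cinner (x + y) z = cinner x z + cinner (y :: 'h :: complex_hilbert) z"
  by (metis cinner_commute cinner_add_right complex_cnj_add)

lemma cinner_scaleC_left:
  "cinner (c *\<^sub>C x) y = cnj c * cinner x (y :: 'h :: complex_hilbert)"
  by (metis cinner_commute cinner_scaleC_right complex_cnj_mult)

lemma cinner_scaleR_right: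
  "cinner x (r *\<^sub>R y) = complex_of_real r * cinner x (y :: 'h :: complex_hilbert)"
  by (simp add: scaleR_scaleC cinner_scaleC_right)

lemma cinner_scaleR_left:
  "cinner (r *\<^sub>R x) y = complex_of_real r * cinner x (y :: 'h :: complex_hilbert)"
  by (simp add: scaleR_scaleC cinner_scaleC_left)

lemma cinner_minus_right: "cinner x (- y) = - cinner x (y :: 'h :: complex_hilbert)"
  using cinner_scaleR_right[of x "-1" y] by simp

lemma cinner_minus_left: "cinner (- x) y = - cinner x (y :: 'h :: complex_hilbert)"
  using cinner_scaleR_left[of "-1" x y] by simp

lemma cinner_diff_right:
  "cinner x (y - z) = cinner x y - cinner x (z :: 'h :: complex_hilbert)"
  using cinner_add_right[of x y "- z"] by (simp add: cinner_minus_right)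

lemma cinner_diff_left:
  "cinner (x - y) z = cinner x z - cinner y (z :: 'h :: complex_hilbert)"
  using cinner_add_left[of x "- y" z] by (simp add: cinner_minus_left)

lemma cinner_self_Re: "Re (cinner x x) = (norm (x :: 'h :: complex_hilbert))\<^sup>2"
proof -
  have "0 \<le> Re (cinner x x)"
    using norm_ge_zero[of x] unfolding norm_eq_sqrt_cinner by simp
  then show ?thesis by (simp add: norm_eq_sqrt_cinner)
qed

lemma cinner_self: "cinner x x = complex_of_real ((norm (x :: 'h :: complex_hilbert))\<^sup>2)"
proof -
  have "Im (cinner x x) = 0"
    by (metis add.inverse_inverse cinner_commute cnj.sel(2) equal_neg_zero)
  then show ?thesis by (simp add: complex_eq_iff cinner_self_Re)
qed

lemma norm_add_sq:
  "(norm (x + y))\<^sup>2 = (norm x)\<^sup>2 + (norm y)\<^sup>2 + 2 * Re (cinner x (y :: 'h :: complex_hilbert))"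
proof -
  have "Re (cinner y x) = Re (cinner x y)"
    by (subst cinner_commute) simp
  then show ?thesis
    by (simp add: cinner_self_Re[symmetric] cinner_add_left cinner_add_right)
qed

lemma Re_cinner_le: "Re (cinner x y) \<le> norm x * norm (y :: 'h :: complex_hilbert)"
proof -
  have "(norm (x + y))\<^sup>2 \<le> (norm x + norm y)\<^sup>2"
    by (simp add: norm_triangle_ineq power_mono)
  then show ?thesis by (simp add: norm_add_sq power2_sum)
qed

lemma norm_scaleC: "norm (c *\<^sub>C x) = cmod c * norm (x :: 'h :: complex_hilbert)"
proof -
  have "(norm (c *\<^sub>C x))\<^sup>2 = (cmod c * norm x)\<^sup>2"
    by (simp add: cinner_self_Re[symmetric] cinner_scaleC_left cinner_scaleC_right)
       (simp add: cinner_self cmod_def power_mult_distrib power2_eq_square algebra_simps)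
  then show ?thesis by (simp add: power2_eq_iff_nonneg)
qed

lemma cauchy_schwarz: "cmod (cinner x y) \<le> norm x * norm (y :: 'h :: complex_hilbert)"
proof (cases "cinner x y = 0")
  case False
  define c where "c = cnj (cinner x y) / cmod (cinner x y)"
  have c: "cmod c = 1" using False by (simp add: c_def norm_divide)
  have "c * cinner x y = complex_of_real (cmod (cinner x y))"
    using False
    by (simp add: c_def complex_norm_square[symmetric] mult.commute power2_eq_square)
  then have "cmod (cinner x y) = Re (cinner x (c *\<^sub>C y))"
    by (simp add: cinner_scaleC_right)
  also have "\<dots> \<le> norm x * norm (c *\<^sub>C y)" by (rule Re_cinner_le)
  finally show ?thesis by (simp add: norm_scaleC c)
qed simp


lemma continuous_cinner_right: "continuous_on S (\<lambda>x. cinner y (x :: 'h :: complex_hilbert))"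
proof (rule linear_continuous_on)
  show "bounded_linear (cinner y)"
    by (rule bounded_linear_intro[where K = "norm y"])
       (simp_all add: cinner_add_right cinner_scaleR_right scaleR_conv_of_real
          cauchy_schwarz mult.commute[of "norm _" "norm y"])
qed

text \<open>The Riesz representation theorem, by minimising
  \<open>(norm x)\<^sup>2 - 2 * Re (f x)\<close>.\<close>

lemma riesz:
  fixes f :: "'h :: complex_hilbert \<Rightarrow> complex"
  assumes add: "\<And>x y. f (x + y) = f x + f y"
    and scale: "\<And>c x. f (c *\<^sub>C x) = c * f x"
    and bound: "\<And>x. cmod (f x) \<le> K * norm x"
  obtains y where "\<And>x. f x = cinner y x"
proof -
  have scaleR: "f (r *\<^sub>R x) = of_real r * f x" for r x
    by (simp add: scaleR_scaleC scale)
  have f: "bounded_linear f"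
    by (rule bounded_linear_intro[where K = K])
       (simp_all add: add scaleR scaleR_conv_of_real bound mult.commute)
  define g where "g x = (norm x)\<^sup>2 - 2 * Re (f x)" for x
  have low: "- K\<^sup>2 \<le> g x" for x
  proof -
    have "Re (f x) \<le> K * norm x"
      using bound[of x] complex_Re_le_cmod[of "f x"] by linarith
    moreover have "0 \<le> (norm x - K)\<^sup>2" by simp
    ultimately show ?thesis unfolding g_def power2_diff by (simp add: algebra_simps)
  qed
  define m where "m = Inf (range g)"
  have bdd: "bdd_below (range g)" using low by (auto intro!: bdd_belowI)
  have m_le: "m \<le> g x" for x unfolding m_def by (rule cInf_lower[OF _ bdd]) simp
  have "\<exists>x. g x < m + 1 / real (Suc n)" for n
    using cInf_lessD[of "range g" "m + 1 / real (Suc n)"] by (auto simp: m_def)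
  then obtain X where X: "\<And>n. g (X n) < m + 1 / real (Suc n)" by metis
  have par: "(norm (x - y))\<^sup>2 \<le> 2 * (g x - m) + 2 * (g y - m)" for x y
  proof -
    have "(norm (x - y))\<^sup>2 + (norm (x + y))\<^sup>2 = 2 * (norm x)\<^sup>2 + 2 * (norm y)\<^sup>2"
      using norm_add_sq[of x y] norm_add_sq[of x "- y"] by (simp add: cinner_minus_right)
    moreover have "(norm ((1/2) *\<^sub>R (x + y)))\<^sup>2 = (norm (x + y))\<^sup>2 / 4"
      by (simp add: power_divide)
    moreover have "Re (f ((1/2) *\<^sub>R (x + y))) = (Re (f x) + Re (f y)) / 2"
      by (simp only: scaleR add) simp
    ultimately show ?thesis using m_le[of "(1/2) *\<^sub>R (x + y)"] unfolding g_def by argo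
  qed
  have "Cauchy X"
  proof (rule metric_CauchyI)
    fix e :: real assume e: "0 < e"
    obtain N where N: "4 / e\<^sup>2 < real N" using reals_Archimedean2 by blast
    have small: "g (X n) - m < e\<^sup>2 / 4" if "n \<ge> N" for n
    proof -
      have "4 / e\<^sup>2 < real (Suc n)" using N that by linarith
      then have "1 / real (Suc n) < e\<^sup>2 / 4" using e by (simp add: field_simps)
      then show ?thesis using X[of n] by linarith
    qed
    have "dist (X i) (X j) < e" if "i \<ge> N" "j \<ge> N" for i j
    proof -
      have "(norm (X i - X j))\<^sup>2 < e\<^sup>2"
        using par[of "X i" "X j"] small[OF that(1)] small[OF that(2)] by argo
      then show ?thesis using e by (simp add: dist_norm power_less_imp_less_base)
    qed
    then show "\<exists>M. \<forall>i\<ge>M. \<forall>j\<ge>M. dist (X i) (X j) < e" by blast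
  qed
  then obtain y where y: "X \<longlonglongrightarrow> y"
    by (auto simp: Cauchy_convergent_iff convergent_def)
  have "(\<lambda>n. g (X n)) \<longlonglongrightarrow> g y"
    unfolding g_def by (intro tendsto_intros y bounded_linear.tendsto[OF f])
  moreover have "(\<lambda>n. m + 1 / real (Suc n)) \<longlonglongrightarrow> m + 0"
    by (intro tendsto_intros LIMSEQ_Suc[OF lim_1_over_n])
  ultimately have "g y \<le> m"
    by (metis (no_types, lifting) X LIMSEQ_le add.right_neutral less_imp_le)
  then have min: "g y \<le> g x" for x using m_le order_trans by blast
  have Re_eq: "Re (f z) = Re (cinner y z)" for z
  proof (rule ccontr)
    define d where "d = Re (cinner y z) - Re (f z)"
    assume "Re (f z) \<noteq> Re (cinner y z)"
    then have d: "d \<noteq> 0" by (simp add: d_def)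
    have *: "0 \<le> t\<^sup>2 * (norm z)\<^sup>2 + 2 * t * d" for t
      using min[of "y + t *\<^sub>R z"] unfolding g_def d_def norm_add_sq
      by (simp add: add scaleR cinner_scaleR_right power_mult_distrib algebra_simps)
    define t where "t = - d / ((norm z)\<^sup>2 + 1)"
    have pos: "(norm z)\<^sup>2 + 1 > 0" by (simp add: add_nonneg_pos)
    have "t\<^sup>2 * ((norm z)\<^sup>2 + 1) = - t * d"
      using pos by (simp add: t_def power2_eq_square)
    moreover have "- t * d > 0"
      using d pos by (simp add: t_def zero_less_divide_iff flip: power2_eq_square)
    ultimately show False using *[of t] zero_le_power2[of t] by (simp add: distrib_left)
  qed
  have "f x = cinner y x" for x
    using Re_eq[of x] Re_eq[of "\<i> *\<^sub>C x"]
    by (simp add: complex_eq_iff scale cinner_scaleC_right)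
  then show ?thesis by (rule that)
qed


section \<open>Bounded operators\<close>

text \<open>The type \<open>'h bop\<close> is the algebra B(H): elements of \<open>'h \<Rightarrow>\<^sub>L 'h\<close>, which are
  only real-linear, that commute with complex scalars.\<close>

typedef (overloaded) ('h :: complex_hilbert) bop =
  "{T :: 'h \<Rightarrow>\<^sub>L 'h. \<forall>c x. T (c *\<^sub>C x) = c *\<^sub>C T x}"
proof
  have "c *\<^sub>C 0 = (0 :: 'h)" for c
    by (metis add_cancel_right_right scaleC_add_right)
  then show "0 \<in> {T :: 'h \<Rightarrow>\<^sub>L 'h. \<forall>c x. T (c *\<^sub>C x) = c *\<^sub>C T x}"
    by simp
qed

setup_lifting type_definition_bop

lift_definition bop_apply :: "'h :: complex_hilbert bop \<Rightarrow> 'h \<Rightarrow> 'h" is blinfun_apply .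

declare [[coercion bop_apply]]

lemma bop_eqI: "(\<And>x. S x = T x) \<Longrightarrow> S = T" for S T :: "'h :: complex_hilbert bop"
  by transfer (rule blinfun_eqI)

lemma bop_add_right: "T (x + y) = T x + T y" for T :: "'h :: complex_hilbert bop"
  by transfer (rule blinfun.add_right)

lemma bop_scaleC_right: "T (c *\<^sub>C x) = c *\<^sub>C T x" for T :: "'h :: complex_hilbert bop"
  by transfer simp

lemma bop_scaleR_right: "T (r *\<^sub>R x) = r *\<^sub>R T x" for T :: "'h :: complex_hilbert bop"
  by transfer (rule blinfun.scaleR_right)

lemma scaleC_minus_right: "c *\<^sub>C (- x) = - (c *\<^sub>C x)" for x :: "'h :: complex_vector"
  by (metis add.right_inverse add_cancel_right_right minus_unique scaleC_add_right)

lemma scaleC_diff_right: "c *\<^sub>C (x - y) = c *\<^sub>C x - c *\<^sub>C y" for x y :: "'h :: complex_vector"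
  by (metis add_uminus_conv_diff scaleC_add_right scaleC_minus_right)

lemma scaleC_scaleR: "c *\<^sub>C r *\<^sub>R x = r *\<^sub>R c *\<^sub>C x" for x :: "'h :: complex_vector"
  by (simp add: scaleR_scaleC scaleC_scaleC mult.commute)

lemma bounded_linear_scaleC: "bounded_linear (\<lambda>x :: 'h :: complex_hilbert. c *\<^sub>C x)"
  by (rule bounded_linear_intro[where K = "cmod c"])
     (simp_all add: scaleC_add_right scaleC_scaleR norm_scaleC mult.commute)

instantiation bop :: (complex_hilbert) complex_vector
begin

lift_definition zero_bop :: "'a bop" is 0
  by (metis add_cancel_right_right scaleC_add_right zero_blinfun.rep_eq)

lift_definition plus_bop :: "'a bop \<Rightarrow> 'a bop \<Rightarrow> 'a bop" is plus
  by (simp add: blinfun.add_left scaleC_add_right)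

lift_definition uminus_bop :: "'a bop \<Rightarrow> 'a bop" is uminus
  by (simp add: blinfun.minus_left scaleC_minus_right)

lift_definition minus_bop :: "'a bop \<Rightarrow> 'a bop \<Rightarrow> 'a bop" is minus
  by (simp add: blinfun.diff_left scaleC_diff_right)

lift_definition scaleR_bop :: "real \<Rightarrow> 'a bop \<Rightarrow> 'a bop" is scaleR
  by (simp add: blinfun.scaleR_left scaleC_scaleR)

lift_definition scaleC_bop :: "complex \<Rightarrow> 'a bop \<Rightarrow> 'a bop" is
  "\<lambda>c T. Blinfun (\<lambda>x. c *\<^sub>C blinfun_apply T x)"
  by (simp add: bounded_linear_Blinfun_apply bounded_linear_compose[OF bounded_linear_scaleC]
      blinfun.bounded_linear_right scaleC_scaleC mult.commute)

lemma scaleC_bop_apply: "(c *\<^sub>C T) x = c *\<^sub>C T x" for T :: "'a bop"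
  by transfer (simp add: bounded_linear_Blinfun_apply
      bounded_linear_compose[OF bounded_linear_scaleC] blinfun.bounded_linear_right)

lemma plus_bop_apply: "(S + T) x = S x + T x" for S T :: "'a bop"
  by transfer (rule blinfun.add_left)

lemma scaleR_bop_apply: "(r *\<^sub>R T) x = r *\<^sub>R T x" for T :: "'a bop"
  by transfer (rule blinfun.scaleR_left)

instance
proof
  fix R S T :: "'a bop" and a b :: real and c d :: complex
  show "R + S + T = R + (S + T)" "S + T = T + S" "0 + T = T" "- T + T = 0" "S - T = S + - T"
    by (transfer; simp)+
  show "a *\<^sub>R (S + T) = a *\<^sub>R S + a *\<^sub>R T" "(a + b) *\<^sub>R T = a *\<^sub>R T + b *\<^sub>R T"
    "a *\<^sub>R b *\<^sub>R T = (a * b) *\<^sub>R T" "1 *\<^sub>R T = T"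
    by (transfer; simp add: algebra_simps)+
  show "c *\<^sub>C (S + T) = c *\<^sub>C S + c *\<^sub>C T" "(c + d) *\<^sub>C T = c *\<^sub>C T + d *\<^sub>C T"
    "c *\<^sub>C d *\<^sub>C T = (c * d) *\<^sub>C T" "a *\<^sub>R T = complex_of_real a *\<^sub>C T"
    by (rule bop_eqI; simp add: scaleC_bop_apply plus_bop_apply scaleR_bop_apply
        scaleC_add_right scaleC_add_left scaleC_scaleC scaleR_scaleC)+
qed

end

instantiation bop :: (complex_hilbert) real_normed_vector
begin

lift_definition norm_bop :: "'a bop \<Rightarrow> real" is norm .

definition sgn_bop :: "'a bop \<Rightarrow> 'a bop" where "sgn_bop T = scaleR (inverse (norm T)) T"
definition dist_bop :: "'a bop \<Rightarrow> 'a bop \<Rightarrow> real" where "dist_bop S T = norm (S - T)"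
definition uniformity_bop :: "('a bop \<times> 'a bop) filter"
  where "uniformity_bop = (INF e\<in>{0 <..}. principal {(S, T). dist S T < e})"
definition open_bop :: "'a bop set \<Rightarrow> bool"
  where "open_bop U \<longleftrightarrow> (\<forall>x\<in>U. eventually (\<lambda>(x', y). x' = x \<longrightarrow> y \<in> U) uniformity)"

instance
proof
  fix S T :: "'a bop" and a :: real
  show "sgn T = T /\<^sub>R norm T" "dist S T = norm (S - T)"
    "uniformity = (INF e\<in>{0 <..}. principal {(S, T :: 'a bop). dist S T < e})"
    by (simp_all add: sgn_bop_def dist_bop_def uniformity_bop_def)
  show "open U \<longleftrightarrow> (\<forall>x\<in>U. \<forall>\<^sub>F (x', y) in uniformity. x' = x \<longrightarrow> y \<in> U)" for U :: "'a bop set"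
    by (simp add: open_bop_def)
  show "norm T = 0 \<longleftrightarrow> T = 0" "norm (S + T) \<le> norm S + norm T"
    "norm (a *\<^sub>R T) = \<bar>a\<bar> * norm T"
    by (transfer; simp add: norm_triangle_ineq)+
qed

end

instance bop :: (complex_hilbert) banach
proof
  fix X :: "nat \<Rightarrow> 'a bop"
  assume X: "Cauchy X"
  have dist: "dist (Rep_bop S) (Rep_bop T) = dist S T" for S T :: "'a bop"
    by (simp add: dist_norm norm_bop.rep_eq minus_bop.rep_eq)
  have "Cauchy (\<lambda>n. Rep_bop (X n))"
    using X by (simp add: Cauchy_def dist)
  then obtain L where L: "(\<lambda>n. Rep_bop (X n)) \<longlonglongrightarrow> L"
    by (auto simp: Cauchy_convergent_iff convergent_def)
  have "L (c *\<^sub>C x) = c *\<^sub>C L x" for c x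
  proof (rule LIMSEQ_unique)
    show "(\<lambda>n. Rep_bop (X n) (c *\<^sub>C x)) \<longlonglongrightarrow> L (c *\<^sub>C x)"
      by (intro tendsto_intros L)
    have "(\<lambda>n. c *\<^sub>C Rep_bop (X n) x) \<longlonglongrightarrow> c *\<^sub>C L x"
      by (intro bounded_linear.tendsto[OF bounded_linear_scaleC] tendsto_intros L)
    moreover have "Rep_bop (X n) (c *\<^sub>C x) = c *\<^sub>C Rep_bop (X n) x" for n
      using Rep_bop[of "X n"] by blast
    ultimately show "(\<lambda>n. Rep_bop (X n) (c *\<^sub>C x)) \<longlonglongrightarrow> c *\<^sub>C L x"
      by presburger
  qed
  then have "Rep_bop (Abs_bop L) = L" by (simp add: Abs_bop_inverse)
  then have "X \<longlonglongrightarrow> Abs_bop L"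
    using L unfolding lim_sequentially dist[symmetric] by simp
  then show "convergent X" by (auto simp: convergent_def)
qed

instantiation bop :: (complex_hilbert) "{real_normed_algebra, monoid_mult}"
begin

lift_definition times_bop :: "'a bop \<Rightarrow> 'a bop \<Rightarrow> 'a bop" is blinfun_compose by simp

lift_definition one_bop :: "'a bop" is id_blinfun by simp

lemma times_bop_apply: "(S * T) x = S (T x)" for S T :: "'a bop"
  by transfer simp

lemma one_bop_apply: "(1 :: 'a bop) x = x"
  by transfer simp

instance
proof
  fix R S T :: "'a bop" and a :: real
  show "R * S * T = R * (S * T)" "1 * T = T" "T * 1 = T"
    by (rule bop_eqI; simp add: times_bop_apply one_bop_apply)+
  show "(R + S) * T = R * T + S * T" "R * (S + T) = R * S + R * T"
    "a *\<^sub>R S * T = a *\<^sub>R (S * T)" "S * a *\<^sub>R T = a *\<^sub>R (S * T)"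
    by (rule bop_eqI; simp add: times_bop_apply plus_bop_apply scaleR_bop_apply
        bop_add_right bop_scaleR_right)+
  show "norm (S * T) \<le> norm S * norm T"
    by transfer (rule norm_blinfun_compose)
qed

end

definition adj :: "'h :: complex_hilbert bop \<Rightarrow> 'h bop"
  where "adj T = (THE S :: 'h bop. \<forall>x y. cinner (S x) y = cinner x (T y))"

lemma norm_bop_apply: "norm (T x) \<le> norm T * norm x" for T :: "'h :: complex_hilbert bop"
  by transfer (rule norm_blinfun)

lemma cinner_eqI:
  assumes "\<And>z. cinner x z = cinner y z"
  shows "x = (y :: 'h :: complex_hilbert)"
proof -
  have "cinner (x - y) (x - y) = 0" by (simp only: cinner_diff_left assms) simp
  then show ?thesis by (simp add: cinner_self)
qed

lemma ex_adj: "\<exists>!S :: 'h bop. \<forall>x y. cinner (S x) y = cinner x (T y)"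
  for T :: "'h :: complex_hilbert bop"
proof (rule ex_ex1I)
  have "\<exists>z. \<forall>y. cinner x (T y) = cinner z y" for x
  proof -
    have "cmod (cinner x (T y)) \<le> (norm x * norm T) * norm y" for y
      using cauchy_schwarz[of x "T y"] mult_left_mono[OF norm_bop_apply[of T y], of "norm x"]
      by (simp add: mult.assoc)
    then obtain z where "\<And>y. cinner x (T y) = cinner z y"
      by (rule riesz[rotated 2])
         (simp_all add: bop_add_right bop_scaleC_right cinner_add_right cinner_scaleC_right)
    then show ?thesis by blast
  qed
  then obtain S where S: "\<And>x y. cinner (S x) y = cinner x (T y)" by metis
  have add: "S (x + y) = S x + S y" for x y
    by (rule cinner_eqI) (simp add: S cinner_add_left)
  have scale: "S (c *\<^sub>C x) = c *\<^sub>C S x" for c x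
    by (rule cinner_eqI) (simp add: S cinner_scaleC_left)
  have bound: "norm (S x) \<le> norm x * norm T" for x
  proof (cases "S x = 0")
    case False
    have "norm (S x) * norm (S x) = cmod (cinner x (T (S x)))"
      by (simp add: S[symmetric] cinner_self power2_eq_square norm_mult)
    also have "\<dots> \<le> norm x * (norm T * norm (S x))"
      using cauchy_schwarz[of x "T (S x)"]
        mult_left_mono[OF norm_bop_apply[of T "S x"], of "norm x"] by simp
    finally show ?thesis using False by simp
  qed simp
  have "bounded_linear S"
    by (rule bounded_linear_intro[where K = "norm T"])
       (simp_all add: add scaleR_scaleC scale bound)
  then have "bop_apply (Abs_bop (Blinfun S)) = S"
    by (simp add: bop_apply.rep_eq Abs_bop_inverse bounded_linear_Blinfun_apply scale)
  then show "\<exists>S :: 'h bop. \<forall>x y. cinner (S x) y = cinner x (T y)" using S by metis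
next
  fix S S' :: "'h bop"
  assume "\<forall>x y. cinner (S x) y = cinner x (T y)" "\<forall>x y. cinner (S' x) y = cinner x (T y)"
  then show "S = S'" by (intro bop_eqI cinner_eqI) simp
qed

lemma cinner_adj: "cinner (adj T x) y = cinner x (T y)" for T :: "'h :: complex_hilbert bop"
  using theI'[OF ex_adj[of T]] unfolding adj_def by blast

text \<open>The library's \<^const>\<open>exp\<close> needs \<open>norm 1 = 1\<close>, which fails on the zero space.\<close>

definition bop_exp :: "'h :: complex_hilbert bop \<Rightarrow> 'h bop"
  where "bop_exp T = (\<Sum>n. T ^ n /\<^sub>R fact n)"

definition ultraweak_topology :: "'h :: complex_hilbert bop topology"
  where "ultraweak_topology = topology_generated_by
    {{T :: 'h bop. (\<Sum>n. cinner (\<xi> n) (T (\<eta> n))) \<in> U} | \<xi> \<eta> U.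
      summable (\<lambda>n. (norm (\<xi> n))\<^sup>2) \<and> summable (\<lambda>n. (norm (\<eta> n))\<^sup>2) \<and> open U}"


section \<open>Von Neumann algebras\<close>

definition commutant :: "'h :: complex_hilbert bop set \<Rightarrow> 'h bop set"
  where "commutant S = {T. \<forall>X\<in>S. T * X = X * T}"

text \<open>A self-adjoint set that equals its bicommutant is automatically a unital \<open>*\<close>-subalgebra.\<close>

definition von_neumann_algebra :: "'h :: complex_hilbert bop set \<Rightarrow> bool"
  where "von_neumann_algebra M \<longleftrightarrow> adj ` M \<subseteq> M \<and> commutant (commutant M) = M"

definition vn_generated :: "'h :: complex_hilbert bop set \<Rightarrow> 'h bop set"
  where "vn_generated S = \<Inter>{M. von_neumann_algebra M \<and> S \<subseteq> M}"


section \<open>Channels\<close>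

text \<open>An \<open>n \<times> n\<close> matrix over B(H) is a function \<open>X :: nat \<Rightarrow> nat \<Rightarrow> 'h bop\<close> of which only the
  entries below \<open>n\<close> matter. It acts on the \<open>n\<close>-fold direct sum of H, whose vectors are the
  \<open>\<xi> :: nat \<Rightarrow> 'h\<close> restricted to \<open>{..<n}\<close>. Positivity and operator norm are those of this
  action.\<close>

definition matrix_positive :: "nat \<Rightarrow> (nat \<Rightarrow> nat \<Rightarrow> 'h :: complex_hilbert bop) \<Rightarrow> bool"
  where "matrix_positive n X \<longleftrightarrow>
    (\<forall>\<xi> :: nat \<Rightarrow> 'h. (\<Sum>i<n. cinner (\<xi> i) (\<Sum>j<n. X i j (\<xi> j))) \<in> \<real>\<^sub>\<ge>\<^sub>0)"

definition matrix_norm :: "nat \<Rightarrow> (nat \<Rightarrow> nat \<Rightarrow> 'h :: complex_hilbert bop) \<Rightarrow> ennreal"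
  where "matrix_norm n X =
    (SUP \<xi> \<in> {\<xi> :: nat \<Rightarrow> 'h. (\<Sum>i<n. (norm (\<xi> i))\<^sup>2) \<le> 1}.
      ennreal (sqrt (\<Sum>i<n. (norm (\<Sum>j<n. X i j (\<xi> j)))\<^sup>2)))"

definition completely_positive :: "('h :: complex_hilbert bop \<Rightarrow> 'h bop) \<Rightarrow> bool"
  where "completely_positive \<Phi> \<longleftrightarrow>
    (\<forall>x y. \<Phi> (x + y) = \<Phi> x + \<Phi> y) \<and> (\<forall>c x. \<Phi> (c *\<^sub>C x) = c *\<^sub>C \<Phi> x) \<and>
    (\<forall>n X. matrix_positive n X \<longrightarrow> matrix_positive n (\<lambda>i j. \<Phi> (X i j)))"

definition cb_norm :: "('h :: complex_hilbert bop \<Rightarrow> 'h bop) \<Rightarrow> ennreal"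
  where "cb_norm \<Phi> =
    (SUP n. SUP X \<in> {X. matrix_norm n X \<le> 1}. matrix_norm n (\<lambda>i j. \<Phi> (X i j)))"

definition normal_ucp :: "('h :: complex_hilbert bop \<Rightarrow> 'h bop) \<Rightarrow> bool"
  where "normal_ucp \<Phi> \<longleftrightarrow> completely_positive \<Phi> \<and> \<Phi> 1 = 1 \<and>
    continuous_map ultraweak_topology ultraweak_topology \<Phi>"

definition kraus_family ::
  "'h :: complex_hilbert bop set \<Rightarrow> 'i set \<Rightarrow> ('i \<Rightarrow> 'h bop) \<Rightarrow> ('h bop \<Rightarrow> 'h bop) \<Rightarrow> bool"
  where "kraus_family M I k \<Phi> \<longleftrightarrow> (\<forall>i\<in>I. k i \<in> M) \<and>
    limitin ultraweak_topology (\<lambda>F. \<Sum>i\<in>F. adj (k i) * k i) 1 (finite_subsets_at_top I) \<and>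
    (\<forall>x. limitin ultraweak_topology (\<lambda>F. \<Sum>i\<in>F. adj (k i) * x * k i) (\<Phi> x)
      (finite_subsets_at_top I))"

text \<open>A definition cannot quantify over the index type, so index sets are taken in the type
  \<open>'h \<times> nat\<close>. It is large enough for every index set of any type, by \<open>inner_channelI\<close> below:
  for each vector \<open>v\<close> only countably many \<open>k i v\<close> are nonzero.\<close>

definition inner_channel :: "'h :: complex_hilbert bop set \<Rightarrow> ('h bop \<Rightarrow> 'h bop) \<Rightarrow> bool"
  where "inner_channel M \<Phi> \<longleftrightarrow>
    normal_ucp \<Phi> \<and> (\<exists>(I :: ('h \<times> nat) set) k. kraus_family M I k \<Phi>)"

definition Chan :: "'h :: complex_hilbert bop set \<Rightarrow> ('h bop \<Rightarrow> 'h bop) set"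
  where "Chan M = {\<Phi>. inner_channel M \<Phi>}"

definition Ad :: "'h :: complex_hilbert bop \<Rightarrow> 'h bop \<Rightarrow> 'h bop"
  where "Ad u x = adj u * x * u"

lemma continuous_map_ultraweak_cinner:
  "continuous_map ultraweak_topology euclidean (\<lambda>T :: 'h bop. cinner v (T w))"
  for v w :: "'h :: complex_hilbert"
proof -
  define e where "e u n = (if n = 0 then u else 0)" for u :: 'h and n :: nat
  have sq: "summable (\<lambda>n. (norm (e u n))\<^sup>2)" for u
    by (rule summable_finite[of "{0}"]) (auto simp: e_def)
  have zero: "cinner 0 x = 0" for x :: 'h
    using cinner_minus_left[of 0 x] by simp
  have e_sum: "(\<Sum>n. cinner (e v n) (T (e w n))) = cinner v (T w)" for T :: "'h bop"
    by (subst suminf_finite[of "{0}"]) (auto simp: e_def zero)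
  then have *: "openin ultraweak_topology {T :: 'h bop. cinner v (T w) \<in> U}" if "open U" for U
    unfolding ultraweak_topology_def
  proof (intro topology_generated_by_Basis CollectI exI conjI)
    show "{T :: 'h bop. cinner v (T w) \<in> U} = {T :: 'h bop. (\<Sum>n. cinner (e v n) (T (e w n))) \<in> U}"
      by (simp add: e_sum)
  qed (use sq that in auto)
  from *[of UNIV] have "topspace (ultraweak_topology :: 'h bop topology) = UNIV"
    using openin_subset by fastforce
  with * show ?thesis by (simp add: continuous_map_def)
qed

lemma inner_channelI:
  fixes I :: "'i set" and k :: "'i \<Rightarrow> 'h :: complex_hilbert bop"
  assumes ucp: "normal_ucp \<Phi>" and fam: "kraus_family M I k \<Phi>"
  shows "inner_channel M \<Phi>"
proof -
  define N where "N = {i \<in> I. k i \<noteq> 0}"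
  have "N \<subseteq> I" by (auto simp: N_def)
  have countable: "countable {i \<in> I. k i v \<noteq> 0}" for v
  proof -
    have "limitin euclidean ((\<lambda>T :: 'h bop. cinner v (T v)) \<circ> (\<lambda>F. \<Sum>i\<in>F. adj (k i) * k i))
        (cinner v ((1 :: 'h bop) v)) (finite_subsets_at_top I)"
      by (rule continuous_map_limit[OF continuous_map_ultraweak_cinner])
         (use fam in \<open>simp add: kraus_family_def\<close>)
    moreover have "cinner v ((\<Sum>i\<in>F. adj (k i) * k i) v)
        = (\<Sum>i\<in>F. complex_of_real ((norm (k i v))\<^sup>2))" for F
    proof (induction F rule: infinite_finite_induct)
      case (insert i F)
      have "cinner v (adj (k i) (k i v)) = complex_of_real ((norm (k i v))\<^sup>2)"
        by (metis cinner_adj cinner_commute cinner_self complex_cnj_complex_of_real)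
      with insert show ?case
        by (simp add: plus_bop_apply times_bop_apply cinner_add_right)
    qed (use cinner_scaleR_right[of v 0 0] in \<open>auto simp: zero_bop.rep_eq bop_apply.rep_eq\<close>)
    ultimately have "((\<lambda>i. complex_of_real ((norm (k i v))\<^sup>2)) has_sum cinner v ((1 :: 'h bop) v)) I"
      by (simp add: has_sum_def o_def)
    then have "(\<lambda>i. complex_of_real ((norm (k i v))\<^sup>2)) summable_on I"
      by (rule has_sum_imp_summable)
    from summable_countable_complex[OF this] show ?thesis by simp
  qed
  have "\<exists>v. k i v \<noteq> 0" if "i \<in> N" for i
    using that bop_eqI[of "k i" 0] by (auto simp: N_def zero_bop.rep_eq bop_apply.rep_eq)
  then obtain v where v: "\<And>i. i \<in> N \<Longrightarrow> k i (v i) \<noteq> 0" by metis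
  define c where "c i = to_nat_on {j \<in> I. k j (v i) \<noteq> 0} i" for i
  define g where "g i = (v i, c i)" for i
  have inj: "inj_on g N"
  proof (rule inj_onI)
    fix i j assume ij: "i \<in> N" "j \<in> N" "g i = g j"
    then have "v i = v j" "c i = c j" by (auto simp: g_def)
    then show "i = j"
      using ij v[of i] v[of j] inj_onD[OF inj_on_to_nat_on[OF countable[of "v j"]], of i j]
      by (auto simp: c_def N_def)
  qed
  define h where "h = the_inv_into N g"
  have h: "h (g i) = i" if "i \<in> N" for i
    unfolding h_def using the_inv_into_f_f[OF inj that] .
  have lim: "limitin ultraweak_topology (\<lambda>F. \<Sum>j\<in>F. f (k (h j))) l (finite_subsets_at_top (g ` N))"
    if "limitin ultraweak_topology (\<lambda>F. \<Sum>i\<in>F. f (k i)) l (finite_subsets_at_top I)"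
      and "f 0 = 0" for f :: "'h bop \<Rightarrow> 'h bop" and l
  proof -
    have "filtermap (\<lambda>F. F \<inter> N) (finite_subsets_at_top I) = finite_subsets_at_top N"
    proof (rule antisym)
      show "filtermap (\<lambda>F. F \<inter> N) (finite_subsets_at_top I) \<le> finite_subsets_at_top N"
        using \<open>N \<subseteq> I\<close>
        unfolding le_filter_def eventually_filtermap eventually_finite_subsets_at_top
        by (metis Int_subset_iff finite_Int inf_le2 subset_trans)
      show "finite_subsets_at_top N \<le> filtermap (\<lambda>F. F \<inter> N) (finite_subsets_at_top I)"
        unfolding le_filter_def eventually_filtermap
      proof (intro allI impI)
        fix P assume "\<forall>\<^sub>F F in finite_subsets_at_top I. P (F \<inter> N)"
        then obtain X where X: "finite X" "X \<subseteq> I"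
          and P: "\<forall>Y. finite Y \<and> X \<subseteq> Y \<and> Y \<subseteq> I \<longrightarrow> P (Y \<inter> N)"
          unfolding eventually_finite_subsets_at_top by (elim exE conjE)
        have "P Z" if "finite Z" "X \<inter> N \<subseteq> Z" "Z \<subseteq> N" for Z
        proof -
          have "(Z \<union> X) \<inter> N = Z" using that by blast
          moreover have "Z \<union> X \<subseteq> I" using that X by (auto simp: N_def)
          ultimately show ?thesis using P[rule_format, of "Z \<union> X"] X that by simp
        qed
        then show "\<forall>\<^sub>F F in finite_subsets_at_top N. P F"
          unfolding eventually_finite_subsets_at_top using X by (intro exI[of _ "X \<inter> N"]) auto
      qed
    qed
    then have filter: "finite_subsets_at_top (g ` N)
        = filtermap (\<lambda>F. g ` (F \<inter> N)) (finite_subsets_at_top I)"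
      using filtermap_image_finite_subsets_at_top[OF inj]
      by (simp add: filtermap_filtermap[symmetric, where f = "(`) g" and g = "\<lambda>F. F \<inter> N"])
    have "(\<Sum>j\<in>g ` (F \<inter> N). f (k (h j))) = (\<Sum>i\<in>F. f (k i))" if "finite F" "F \<subseteq> I" for F
    proof -
      have "(\<Sum>j\<in>g ` (F \<inter> N). f (k (h j))) = (\<Sum>i\<in>F \<inter> N. f (k i))"
        by (subst sum.reindex) (auto intro: inj_on_subset[OF inj] simp: h)
      also have "\<dots> = (\<Sum>i\<in>F. f (k i))"
        by (rule sum.mono_neutral_left) (use that \<open>f 0 = 0\<close> in \<open>auto simp: N_def\<close>)
      finally show ?thesis .
    qed
    then have "\<forall>\<^sub>F F in finite_subsets_at_top I.
        (\<Sum>i\<in>F. f (k i)) = (\<Sum>j\<in>g ` (F \<inter> N). f (k (h j)))"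
      by (intro eventually_finite_subsets_at_top_weakI) simp
    from limitin_transform_eventually[OF this that(1)] show ?thesis
      unfolding filter limitin_def by (simp add: eventually_filtermap)
  qed
  have "kraus_family M (g ` N) (k \<circ> h) \<Phi>"
    unfolding kraus_family_def
  proof (intro conjI ballI allI)
    show "(k \<circ> h) j \<in> M" if "j \<in> g ` N" for j
      using that fam h by (auto simp: kraus_family_def N_def)
    show "limitin ultraweak_topology (\<lambda>F. \<Sum>j\<in>F. adj ((k \<circ> h) j) * (k \<circ> h) j) 1
        (finite_subsets_at_top (g ` N))"
      using lim[of "\<lambda>T. adj T * T" 1] fam by (simp add: kraus_family_def)
    show "limitin ultraweak_topology (\<lambda>F. \<Sum>j\<in>F. adj ((k \<circ> h) j) * x * (k \<circ> h) j) (\<Phi> x)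
        (finite_subsets_at_top (g ` N))" for x
      using lim[of "\<lambda>T. adj T * x * T" "\<Phi> x"] fam by (simp add: kraus_family_def)
  qed
  with ucp show ?thesis unfolding inner_channel_def by blast
qed


section \<open>Haag--Kastler nets on Minkowski space\<close>

text \<open>Minkowski space is \<open>real \<times> 'v\<close>, time times space, where the spatial dimension \<open>DIM('v)\<close> is
  an arbitrary positive number.\<close>

definition future_timelike :: "real \<times> 'v :: euclidean_space \<Rightarrow> bool"
  where "future_timelike z \<longleftrightarrow> norm (snd z) < fst z"

definition spacelike :: "real \<times> 'v :: euclidean_space \<Rightarrow> bool"
  where "spacelike z \<longleftrightarrow> \<bar>fst z\<bar> < norm (snd z)"

definition double_cone :: "(real \<times> 'v :: euclidean_space) set \<Rightarrow> bool"
  where "double_cone D \<longleftrightarrow> (\<exists>p q. future_timelike (q - p) \<and>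
    D = {z. future_timelike (z - p) \<and> future_timelike (q - z)})"

text \<open>The interior makes the causal complement an open region. It contains the same double
  cones as the closed set of points spacelike to \<open>D\<close>.\<close>

definition causal_complement ::
  "(real \<times> 'v :: euclidean_space) set \<Rightarrow> (real \<times> 'v) set"
  where "causal_complement D = interior {z. \<forall>w\<in>D. spacelike (z - w)}"

text \<open>A net is a function on all sets of which only the values at double cones matter.\<close>

definition haag_kastler_net ::
  "((real \<times> 'v :: euclidean_space) set \<Rightarrow> 'h :: complex_hilbert bop set) \<Rightarrow> bool"
  where "haag_kastler_net A \<longleftrightarrow>
    (\<forall>D. double_cone D \<longrightarrow> von_neumann_algebra (A D)) \<and>
    (\<forall>D E. double_cone D \<and> double_cone E \<and> D \<subseteq> E \<longrightarrow> A D \<subseteq> A E) \<and>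
    (\<forall>D E. double_cone D \<and> double_cone E \<and> D \<subseteq> causal_complement E \<longrightarrow>
      (\<forall>x\<in>A D. \<forall>y\<in>A E. x * y = y * x))"

definition region_algebra ::
  "((real \<times> 'v :: euclidean_space) set \<Rightarrow> 'h :: complex_hilbert bop set)
    \<Rightarrow> (real \<times> 'v) set \<Rightarrow> 'h bop set"
  where "region_algebra A R = vn_generated (\<Union>D\<in>{D. double_cone D \<and> D \<subseteq> R}. A D)"

definition dual_net ::
  "((real \<times> 'v :: euclidean_space) set \<Rightarrow> 'h :: complex_hilbert bop set)
    \<Rightarrow> (real \<times> 'v) set \<Rightarrow> 'h bop set"
  where "dual_net A D = commutant (region_algebra A (causal_complement D))"

definition haag_duality_at ::
  "((real \<times> 'v :: euclidean_space) set \<Rightarrow> 'h :: complex_hilbert bop set)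
    \<Rightarrow> (real \<times> 'v) set \<Rightarrow> bool"
  where "haag_duality_at A D \<longleftrightarrow> A D = dual_net A D"

definition NS ::
  "((real \<times> 'v :: euclidean_space) set \<Rightarrow> 'h :: complex_hilbert bop set)
    \<Rightarrow> (real \<times> 'v) set \<Rightarrow> ('h bop \<Rightarrow> 'h bop) set"
  where "NS A D = {\<Phi>. normal_ucp \<Phi> \<and> (\<forall>y\<in>region_algebra A (causal_complement D). \<Phi> y = y)}"

end

theory Submission
  imports Defs
begin

text \<open>Every inner channel of \<open>A D\<close> fixes the commutant of \<open>A D\<close> pointwise, so \<open>Ad u\<close> can be inner
  only if the unitary \<open>u\<close> lies in the bicommutant \<open>A D\<close>. If \<open>exp (i t a)\<close> lay in \<open>A D\<close> for
  arbitrarily small \<open>t \<noteq> 0\<close>, then so would the norm limit \<open>a\<close> of \<open>(exp (i t a) - 1) / (i t)\<close>.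

  Conversely, a normal unital completely positive map has a Kraus decomposition, and the Kraus
  operators commute with every *-algebra fixed by the map, so under Haag duality they lie in
  \<open>A D\<close>. The Kraus operators come from writing the positive definite kernel
  \<open>((v, h), (w, g)) \<mapsto> \<langle>h, \<Phi> (|v\<rangle>\<langle>w|) g\<rangle>\<close> as a sum of rank one kernels. This gives the
  decomposition on operators of rank one, and normality extends it, because finite rank
  projections are ultraweakly close to 1.\<close>

section \<open>Operators on a complex Hilbert space\<close>

text \<open>The kernel is forced by the goal: if \<Phi> x is a sum of terms
  \<open>adj k * x * k\<close>, then \<langle>h, \<Phi> (|v\<rangle>\<langle>w|) g\<rangle> is the
  sum of \<open>cnj (cinner v (k h)) * cinner w (k g)\<close>, one rank one kernel for each
  \<open>k\<close>. Conversely, every function split off from the kernel is dominated by it, and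
  domination makes it sesquilinear and bounded, hence the matrix coefficient function of an
  operator. The obstacle is that normality is only a continuity statement, while the sums run over
  arbitrary index sets, so the limit in the operator must be exchanged with an infinite sum. The
  identity on finite rank operators therefore first yields that the squares of
  \<open>norm (k h)\<close> add up to the square of \<open>norm h\<close>; this mass balance
  controls the terms belonging to a general operator. The net enters through two facts:
  \<open>A D\<close> is a von Neumann algebra, and by locality the algebra of the causal complement
  lies in its commutant. When duality fails, the dual net contains a self-adjoint element outside
  \<open>A D\<close>, so the claim about \<open>Ad\<close> also proves that (iii) implies
  (i).\<close>

lemma cinner_zero_right [simp]: "cinner x (0 :: 'h :: complex_hilbert) = 0"
  using cinner_scaleR_right[of x 0 0] by simp

lemma cinner_zero_left [simp]: "cinner (0 :: 'h :: complex_hilbert) x = 0"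
  using cinner_scaleR_left[of 0 0 x] by simp

lemma scaleC_zero_left [simp]: "0 *\<^sub>C x = (0 :: 'h :: complex_vector)"
  using scaleR_scaleC[of 0 x] by simp

lemma scaleC_zero_right [simp]: "c *\<^sub>C 0 = (0 :: 'h :: complex_vector)"
  using scaleC_diff_right[of c "0 :: 'h" 0] by simp

lemma scaleC_one [simp]: "1 *\<^sub>C x = (x :: 'h :: complex_vector)"
  using scaleR_scaleC[of 1 x] by simp

lemma scaleC_minus_left: "(- c) *\<^sub>C x = - (c *\<^sub>C x)" for x :: "'h :: complex_vector"
  using scaleC_add_left[of c "- c" x] by (simp add: minus_unique)

lemma scaleC_sum_right: "c *\<^sub>C (\<Sum>i\<in>I. f i) = (\<Sum>i\<in>I. c *\<^sub>C (f i :: 'h :: complex_vector))"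
  by (induction I rule: infinite_finite_induct) (simp_all add: scaleC_add_right)

lemma scaleC_sum_left: "(\<Sum>i\<in>I. f i) *\<^sub>C x = (\<Sum>i\<in>I. f i *\<^sub>C (x :: 'h :: complex_vector))"
  by (induction I rule: infinite_finite_induct) (simp_all add: scaleC_add_left)

lemma cinner_sum_right:
  "cinner x (\<Sum>i\<in>I. f i) = (\<Sum>i\<in>I. cinner x (f i :: 'h :: complex_hilbert))"
  by (induction I rule: infinite_finite_induct) (simp_all add: cinner_add_right)

lemma cinner_sum_left:
  "cinner (\<Sum>i\<in>I. f i) x = (\<Sum>i\<in>I. cinner (f i :: 'h :: complex_hilbert) x)"
  by (induction I rule: infinite_finite_induct) (simp_all add: cinner_add_left)

lemma bop_zero_apply [simp]: "(0 :: 'h :: complex_hilbert bop) x = 0"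
  by transfer simp

lemma bop_diff_apply: "(S - T) x = S x - T x" for S T :: "'h :: complex_hilbert bop"
  by transfer (rule blinfun.diff_left)

lemma bop_zero_right [simp]: "T 0 = 0" for T :: "'h :: complex_hilbert bop"
  by transfer simp

lemma bop_diff_right: "T (x - y) = T x - T y" for T :: "'h :: complex_hilbert bop"
  by transfer (rule blinfun.diff_right)

lemma bop_sum_right: "T (\<Sum>i\<in>I. f i) = (\<Sum>i\<in>I. T (f i))" for T :: "'h :: complex_hilbert bop"
  by (induction I rule: infinite_finite_induct) (simp_all add: bop_add_right)

lemma bop_sum_apply:
  "bop_apply (\<Sum>i\<in>I. f i) x = (\<Sum>i\<in>I. f i x)" for f :: "'i \<Rightarrow> 'h :: complex_hilbert bop"
  by (induction I rule: infinite_finite_induct) (simp_all add: plus_bop_apply)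

lemma bop_eqI_cinner:
  fixes S T :: "'h :: complex_hilbert bop"
  assumes "\<And>v w. cinner v (S w) = cinner v (T w)"
  shows "S = T"
  by (intro bop_eqI cinner_eqI) (metis assms cinner_commute)

lemma norm_bop_leI:
  fixes T :: "'h :: complex_hilbert bop"
  assumes "0 \<le> K" "\<And>x. norm (T x) \<le> K * norm x"
  shows "norm T \<le> K"
  using assms by transfer (rule norm_blinfun_bound)

lemma norm_one_bop_le: "norm (1 :: 'h :: complex_hilbert bop) \<le> 1"
  by (rule norm_bop_leI) (simp_all add: one_bop_apply)

lemma times_scaleC_left: "(c *\<^sub>C S) * T = c *\<^sub>C (S * T)" for S T :: "'h :: complex_hilbert bop"
  by (rule bop_eqI) (simp add: times_bop_apply scaleC_bop_apply)

lemma times_scaleC_right: "S * (c *\<^sub>C T) = c *\<^sub>C (S * T)" for S T :: "'h :: complex_hilbert bop"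
  by (rule bop_eqI) (simp add: times_bop_apply scaleC_bop_apply bop_scaleC_right)

lemma norm_scaleC_bop_le: "norm (c *\<^sub>C T) \<le> cmod c * norm T" for T :: "'h :: complex_hilbert bop"
proof (rule norm_bop_leI)
  show "norm ((c *\<^sub>C T) x) \<le> cmod c * norm T * norm x" for x
    using mult_left_mono[OF norm_bop_apply[of T x], of "cmod c"]
    by (simp add: scaleC_bop_apply norm_scaleC mult.assoc)
qed simp

text \<open>\<open>B\<close> is antilinear in its first argument, so \<open>cnj (B v w)\<close> is
  linear in \<open>v\<close> and the Riesz theorem applies for each \<open>w\<close>. This later
  turns the pieces of a kernel into Kraus operators.\<close>

lemma bop_of_form:
  fixes B :: "'h :: complex_hilbert \<Rightarrow> 'h \<Rightarrow> complex"
  assumes add_right: "\<And>v w w'. B v (w + w') = B v w + B v w'"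
    and scale_right: "\<And>v c w. B v (c *\<^sub>C w) = c * B v w"
    and add_left: "\<And>v v' w. B (v + v') w = B v w + B v' w"
    and scale_left: "\<And>v c w. B (c *\<^sub>C v) w = cnj c * B v w"
    and bound: "\<And>v w. cmod (B v w) \<le> K * norm v * norm w"
  obtains T :: "'h bop" where "\<And>v w. cinner v (T w) = B v w"
proof -
  have "\<exists>y. \<forall>v. cnj (B v w) = cinner y v" for w
  proof -
    have "cmod (cnj (B v w)) \<le> (K * norm w) * norm v" for v
      using bound[of v w] by (simp add: mult_ac)
    then obtain y where "\<And>v. cnj (B v w) = cinner y v"
      by (rule riesz[rotated 2]) (simp_all add: add_left scale_left)
    then show ?thesis by blast
  qed
  then obtain S where S: "\<And>v w. cnj (B v w) = cinner (S w) v" by metis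
  have SB: "cinner v (S w) = B v w" for v w
    by (metis S cinner_commute complex_cnj_cnj)
  have eqI: "x = y" if "\<And>v. cinner v x = cinner v y" for x y :: 'h
    by (rule cinner_eqI) (metis that cinner_commute)
  have add: "S (x + y) = S x + S y" for x y
    by (rule eqI) (simp add: SB cinner_add_right add_right)
  have scale: "S (c *\<^sub>C x) = c *\<^sub>C S x" for c x
    by (rule eqI) (simp add: SB cinner_scaleC_right scale_right)
  have bnd: "norm (S x) \<le> norm x * K" for x
  proof (cases "S x = 0")
    case False
    have "norm (S x) * norm (S x) = cmod (B (S x) x)"
      by (simp add: SB[symmetric] cinner_self power2_eq_square norm_mult)
    also have "\<dots> \<le> (norm x * K) * norm (S x)"
      using bound[of "S x" x] by (simp add: mult_ac)
    finally show ?thesis using False by simp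
  next
    case True
    \<comment> \<open>The sign comes from \<open>bound\<close> at \<open>v = w = x\<close>, which
      forces \<open>0 \<le> K\<close> as soon as \<open>x \<noteq> 0\<close>.\<close>
    have "norm x * K \<ge> 0"
    proof (cases "x = 0")
      case False
      have "0 \<le> K * norm x * norm x" using bound[of x x] norm_ge_zero order_trans by blast
      then show ?thesis using False by (simp add: zero_le_mult_iff mult.commute)
    qed simp
    with True show ?thesis by simp
  qed
  have "bounded_linear S"
    by (rule bounded_linear_intro[where K = K]) (simp_all add: add scaleR_scaleC scale bnd)
  then have "bop_apply (Abs_bop (Blinfun S)) = S"
    by (simp add: bop_apply.rep_eq Abs_bop_inverse bounded_linear_Blinfun_apply scale)
  then show ?thesis using SB that by metis
qed


subsection \<open>Adjoints\<close>

lemma cinner_adj_right: "cinner x (adj T y) = cinner (T x) y" for T :: "'h :: complex_hilbert bop"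
  by (metis cinner_adj cinner_commute)

lemma adj_unique:
  fixes S T :: "'h :: complex_hilbert bop"
  assumes "\<And>x y. cinner (S x) y = cinner x (T y)"
  shows "adj T = S"
  by (intro bop_eqI cinner_eqI) (simp add: cinner_adj assms)

lemma adj_adj [simp]: "adj (adj T) = T" for T :: "'h :: complex_hilbert bop"
  by (rule adj_unique) (simp add: cinner_adj_right)

lemma adj_times: "adj (S * T) = adj T * adj S" for S T :: "'h :: complex_hilbert bop"
  by (rule adj_unique) (simp add: times_bop_apply cinner_adj)

lemma adj_add: "adj (S + T) = adj S + adj T" for S T :: "'h :: complex_hilbert bop"
  by (rule adj_unique) (simp add: plus_bop_apply cinner_add_left cinner_add_right cinner_adj)

lemma adj_scaleC: "adj (c *\<^sub>C T) = cnj c *\<^sub>C adj T" for T :: "'h :: complex_hilbert bop"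
  by (rule adj_unique)
     (simp add: scaleC_bop_apply cinner_scaleC_left cinner_scaleC_right cinner_adj)

lemma adj_one [simp]: "adj 1 = (1 :: 'h :: complex_hilbert bop)"
  by (rule adj_unique) (simp add: one_bop_apply)

lemma norm_adj_le: "norm (adj T) \<le> norm T" for T :: "'h :: complex_hilbert bop"
proof (rule norm_bop_leI)
  fix x
  show "norm (adj T x) \<le> norm T * norm x"
  proof (cases "adj T x = 0")
    case False
    have "norm (adj T x) * norm (adj T x) = cmod (cinner x (T (adj T x)))"
      by (simp add: cinner_adj[symmetric] cinner_self power2_eq_square norm_mult)
    also have "\<dots> \<le> norm x * (norm T * norm (adj T x))"
      using cauchy_schwarz[of x "T (adj T x)"]
        mult_left_mono[OF norm_bop_apply[of T "adj T x"], of "norm x"] by simp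
    finally show ?thesis using False by (simp add: mult_ac)
  qed simp
qed simp

lemma bounded_linear_adj: "bounded_linear (adj :: 'h :: complex_hilbert bop \<Rightarrow> 'h bop)"
  by (rule bounded_linear_intro[where K = 1])
     (simp_all add: adj_add scaleR_scaleC adj_scaleC norm_adj_le)


subsection \<open>Finite rank operators\<close>

text \<open>The operator |v\<rangle>\<langle>w|, linear in \<open>v\<close> and antilinear in
  \<open>w\<close>.\<close>

definition ketbra :: "'h :: complex_hilbert \<Rightarrow> 'h \<Rightarrow> 'h bop"
  where "ketbra v w = Abs_bop (Blinfun (\<lambda>x. cinner w x *\<^sub>C v))"

lemma ketbra_apply: "ketbra v w x = cinner w x *\<^sub>C v" for v :: "'h :: complex_hilbert"
proof -
  have "bounded_linear (\<lambda>x. cinner w x *\<^sub>C v)"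
  proof (rule bounded_linear_intro[where K = "norm w * norm v"])
    show "norm (cinner w x *\<^sub>C v) \<le> norm x * (norm w * norm v)" for x
      using mult_right_mono[OF cauchy_schwarz[of w x], of "norm v"]
      by (simp add: norm_scaleC mult_ac)
  qed (simp_all add: cinner_add_right scaleC_add_left scaleR_scaleC cinner_scaleC_right scaleC_scaleC)
  then show ?thesis
    by (simp add: ketbra_def bop_apply.rep_eq Abs_bop_inverse bounded_linear_Blinfun_apply
        cinner_scaleC_right scaleC_scaleC)
qed

lemma ketbra_sum_left: "ketbra (\<Sum>i\<in>I. f i) w = (\<Sum>i\<in>I. ketbra (f i) w)"
  for w :: "'h :: complex_hilbert"
  by (rule bop_eqI) (simp add: ketbra_apply bop_sum_apply scaleC_sum_right)

lemma ketbra_sum_right: "ketbra v (\<Sum>i\<in>I. f i) = (\<Sum>i\<in>I. ketbra v (f i))"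
  for v :: "'h :: complex_hilbert"
  by (rule bop_eqI) (simp add: ketbra_apply bop_sum_apply scaleC_sum_left cinner_sum_left)

lemma ketbra_scaleC_left: "ketbra (c *\<^sub>C v) w = c *\<^sub>C ketbra v w"
  for v :: "'h :: complex_hilbert"
  by (rule bop_eqI) (simp add: ketbra_apply scaleC_bop_apply scaleC_scaleC mult.commute)

lemma ketbra_scaleC_right: "ketbra v (c *\<^sub>C w) = cnj c *\<^sub>C ketbra v w"
  for v :: "'h :: complex_hilbert"
  by (rule bop_eqI) (simp add: ketbra_apply scaleC_bop_apply scaleC_scaleC cinner_scaleC_left)

lemma ketbra_zero [simp]: "ketbra 0 w = (0 :: 'h :: complex_hilbert bop)"
  by (rule bop_eqI) (simp add: ketbra_apply)

lemma ketbra_times: "ketbra v w * T = ketbra v (adj T w)" for T :: "'h :: complex_hilbert bop"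
  by (rule bop_eqI) (simp add: ketbra_apply times_bop_apply cinner_adj)

definition orthonormal :: "'h :: complex_hilbert set \<Rightarrow> bool"
  where "orthonormal E \<longleftrightarrow> (\<forall>e\<in>E. \<forall>f\<in>E. cinner e f = (if e = f then 1 else 0))"

text \<open>For finite orthonormal \<open>E\<close> this is the orthogonal projection onto the span
  of \<open>E\<close>; for infinite \<open>E\<close> it is 0 by the convention for sums.\<close>

definition proj :: "'h :: complex_hilbert set \<Rightarrow> 'h bop"
  where "proj E = (\<Sum>e\<in>E. ketbra e e)"

lemma proj_apply: "proj E x = (\<Sum>e\<in>E. cinner e x *\<^sub>C e)" for x :: "'h :: complex_hilbert"
  by (simp add: proj_def bop_sum_apply ketbra_apply)

lemma adj_proj [simp]: "adj (proj E) = (proj E :: 'h :: complex_hilbert bop)"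
proof (rule adj_unique)
  fix x y :: 'h
  have "cnj (cinner e x) = cinner x e" for e
    using cinner_commute[of x e] by simp
  then show "cinner (proj E x) y = cinner x (proj E y)"
    by (simp add: proj_apply cinner_sum_left cinner_sum_right cinner_scaleC_left
        cinner_scaleC_right mult.commute)
qed

lemma proj_member:
  assumes "finite E" "orthonormal E" "e \<in> E"
  shows "proj E e = (e :: 'h :: complex_hilbert)"
proof -
  have "proj E e = (\<Sum>f\<in>E. if f = e then e else 0)"
    unfolding proj_apply
    by (rule sum.cong) (use assms in \<open>auto simp: orthonormal_def\<close>)
  then show ?thesis using assms by simp
qed

lemma proj_idem:
  assumes "finite E" "orthonormal E"
  shows "proj E (proj E x) = proj E (x :: 'h :: complex_hilbert)"
  by (subst (2 3) proj_apply) (simp add: bop_sum_right bop_scaleC_right proj_member[OF assms])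

lemma cinner_proj_self:
  assumes "finite E" "orthonormal E"
  shows "cinner x (proj E x) = of_real ((norm (proj E (x :: 'h :: complex_hilbert)))\<^sup>2)"
  by (metis adj_proj assms cinner_adj cinner_self proj_idem)

lemma norm_proj_pythagoras:
  assumes "finite E" "orthonormal E"
  shows "(norm (proj E x))\<^sup>2 + (norm (x - proj E x))\<^sup>2 = (norm (x :: 'h :: complex_hilbert))\<^sup>2"
proof -
  have "cinner (proj E x) (x - proj E x) = 0"
    by (metis adj_proj assms bop_diff_right cinner_adj cinner_zero_right proj_idem
        right_minus_eq)
  then show ?thesis using norm_add_sq[of "proj E x" "x - proj E x"] by simp
qed

lemma norm_diff_proj_le:
  assumes "finite E" "orthonormal E"
  shows "norm (x - proj E x) \<le> norm (x :: 'h :: complex_hilbert)"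
  using norm_proj_pythagoras[OF assms, of x] zero_le_power2[of "norm (proj E x)"]
  by (intro power2_le_imp_le[OF _ norm_ge_zero]) linarith

lemma norm_proj_le:
  assumes "finite E" "orthonormal E"
  shows "norm (proj E x) \<le> norm (x :: 'h :: complex_hilbert)"
  using norm_proj_pythagoras[OF assms, of x] zero_le_power2[of "norm (x - proj E x)"]
  by (intro power2_le_imp_le[OF _ norm_ge_zero]) linarith

text \<open>Gram-Schmidt: if the projection built so far moves \<open>b\<close>, the normalised
  remainder \<open>f\<close> is adjoined. Vectors already fixed stay fixed, because \<open>f\<close>
  is orthogonal to the range of \<open>proj E\<close>.\<close>

lemma exists_proj_fixing:
  assumes "finite (B :: 'h :: complex_hilbert set)"
  shows "\<exists>E. finite E \<and> orthonormal E \<and> (\<forall>b\<in>B. proj E b = b)"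
  using assms
proof (induction B)
  case empty
  show ?case by (intro exI[of _ "{}"]) (simp add: orthonormal_def)
next
  case (insert b B)
  then obtain E where E: "finite E" "orthonormal E" "\<And>b. b \<in> B \<Longrightarrow> proj E b = b" by blast
  show ?case
  proof (cases "proj E b = b")
    case True
    with E show ?thesis by blast
  next
    case False
    define r where "r = b - proj E b"
    define f where "f = (1 / norm r) *\<^sub>R r"
    have r: "r \<noteq> 0" using False by (simp add: r_def)
    have ff: "cinner f f = 1" using r by (simp add: cinner_self f_def)
    have er: "cinner e r = 0" if "e \<in> E" for e
      by (metis E(1,2) adj_proj bop_diff_right cinner_adj cinner_zero_right diff_self
          proj_idem proj_member r_def that)
    then have ef: "cinner e f = 0" if "e \<in> E" for e
      using that by (simp add: f_def cinner_scaleR_right)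
    then have fe: "cinner f e = 0" if "e \<in> E" for e
      using that by (metis cinner_commute complex_cnj_zero)
    have nin: "f \<notin> E" using ef ff by force
    have "orthonormal (insert f E)"
      using E(2) ff ef fe nin unfolding orthonormal_def by auto
    moreover have ins: "proj (insert f E) x = cinner f x *\<^sub>C f + proj E x" for x
      using E(1) nin by (simp add: proj_apply)
    moreover have "proj (insert f E) x = x" if "x \<in> B" for x
    proof -
      have "cinner f x = cinner (proj E f) x"
        by (metis E(3) adj_proj cinner_adj that)
      also have "proj E f = 0" by (simp add: proj_apply ef)
      finally show ?thesis using E(3)[OF that] by (simp add: ins)
    qed
    moreover have "proj (insert f E) b = b"
    proof -
      have "proj E f = 0" by (simp add: proj_apply ef)
      then have "cinner f (proj E b) = 0"
        by (metis adj_proj cinner_adj cinner_zero_left)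
      then have "cinner f b = cinner f r" by (simp add: r_def cinner_diff_right)
      also have "r = norm r *\<^sub>R f" using r by (simp add: f_def)
      then have "cinner f r = norm r" using ff by (metis cinner_scaleR_right mult.right_neutral)
      finally have "cinner f b *\<^sub>C f = norm r *\<^sub>R f" by (simp add: scaleR_scaleC)
      also have "\<dots> = r" using r by (simp add: f_def)
      finally show ?thesis by (simp add: ins r_def)
    qed
    ultimately show ?thesis using E(1) by (intro exI[of _ "insert f E"]) simp
  qed
qed


section \<open>Positive definite kernels\<close>

lemma has_sum_sum:
  fixes f :: "'i \<Rightarrow> 'a \<Rightarrow> 'b :: topological_comm_monoid_add"
  assumes "\<And>i. i \<in> I \<Longrightarrow> (f i has_sum s i) A"
  shows "((\<lambda>x. \<Sum>i\<in>I. f i x) has_sum (\<Sum>i\<in>I. s i)) A"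
  using assms by (induction I rule: infinite_finite_induct) (auto intro: has_sum_add)

text \<open>The points form a sequence and may repeat, so linear relations between points can be
  tested without distinguishing coincident ones.\<close>

definition kernel_form ::
  "('x \<Rightarrow> 'x \<Rightarrow> complex) \<Rightarrow> nat \<Rightarrow> (nat \<Rightarrow> 'x) \<Rightarrow> (nat \<Rightarrow> complex) \<Rightarrow> complex"
  where "kernel_form K n x c = (\<Sum>i<n. \<Sum>j<n. cnj (c i) * c j * K (x i) (x j))"

definition positive_kernel :: "('x \<Rightarrow> 'x \<Rightarrow> complex) \<Rightarrow> bool"
  where "positive_kernel K \<longleftrightarrow> (\<forall>n x c. kernel_form K n x c \<in> \<real>\<^sub>\<ge>\<^sub>0)"

lemma positive_kernelD:
  assumes "positive_kernel K"
  shows "0 \<le> Re (kernel_form K n x c)" "Im (kernel_form K n x c) = 0"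
  using assms by (auto simp: positive_kernel_def complex_nonneg_Reals_iff)

lemma positive_kernel_diag:
  assumes "positive_kernel K"
  shows "0 \<le> Re (K x x)" "Im (K x x) = 0"
proof -
  have "kernel_form K 1 (\<lambda>_. x) (\<lambda>_. 1) = K x x" by (simp add: kernel_form_def)
  then show "0 \<le> Re (K x x)" "Im (K x x) = 0"
    using positive_kernelD[OF assms] by metis+
qed

text \<open>Polarisation: reality of the form with coefficients (1, 1) gives the imaginary part of
  the identity, with coefficients (1, \<i>) the real part.\<close>

lemma positive_kernel_hermitian:
  assumes "positive_kernel K"
  shows "K y x = cnj (K x y)"
proof -
  have *: "Im (kernel_form K 2 (\<lambda>i. if i = 0 then x else y) (\<lambda>i. if i = 0 then 1 else c)) = 0" for c
    by (rule positive_kernelD(2)[OF assms])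
  from *[of 1] *[of \<i>] positive_kernel_diag[OF assms]
  show ?thesis by (simp add: kernel_form_def lessThan_Suc numeral_2_eq_2 complex_eq_iff)
qed

text \<open>Adjoining one point makes the form a quadratic polynomial in the new coefficient
  \<open>s\<close>, which the Cauchy-Schwarz argument then minimises.\<close>

lemma kernel_form_extend:
  fixes n :: nat and c :: "nat \<Rightarrow> complex" and x :: "nat \<Rightarrow> 'x" and z :: 'x
  assumes "positive_kernel K"
  defines "L \<equiv> (\<Sum>j<n. c j * K z (x j))"
  shows "kernel_form K (Suc n) (x(n := z)) (c(n := s)) =
    kernel_form K n x c + s * cnj L + cnj s * L + cnj s * s * K z z"
proof -
  have "kernel_form K (Suc n) (x(n := z)) (c(n := s)) =
      (\<Sum>i<n. (\<Sum>j<n. cnj (c i) * c j * K (x i) (x j)) + cnj (c i) * s * K (x i) z) +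
      ((\<Sum>j<n. cnj s * c j * K z (x j)) + cnj s * s * K z z)"
    by (simp add: kernel_form_def)
  also have "(\<Sum>j<n. cnj s * c j * K z (x j)) = cnj s * L"
    by (simp add: L_def sum_distrib_left mult.assoc)
  also have "(\<Sum>i<n. (\<Sum>j<n. cnj (c i) * c j * K (x i) (x j)) + cnj (c i) * s * K (x i) z) =
      kernel_form K n x c + s * cnj L"
    by (simp add: sum.distrib kernel_form_def L_def sum_distrib_left
        positive_kernel_hermitian[OF assms(1), of _ z] mult_ac)
  finally show ?thesis by (simp only: add.assoc)
qed

text \<open>This is the Cauchy-Schwarz inequality of the reproducing kernel space, obtained from the
  nonnegativity of the extended form without constructing that space.\<close>

lemma positive_kernel_cauchy_schwarz:
  assumes "positive_kernel K"
  shows "(cmod (\<Sum>j<n. c j * K z (x j)))\<^sup>2 \<le> Re (K z z) * Re (kernel_form K n x c)"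
proof -
  define L where "L = (\<Sum>j<n. c j * K z (x j))"
  define d where "d = Re (K z z)"
  define Q where "Q = Re (kernel_form K n x c)"
  have d: "K z z = of_real d" "d \<ge> 0"
    using positive_kernel_diag[OF assms, of z] by (simp_all add: d_def complex_eq_iff)
  have Q: "Q \<ge> 0"
    using positive_kernelD[OF assms] by (simp add: Q_def)
  have ge: "0 \<le> Q - 2 * r * (cmod L)\<^sup>2 + r\<^sup>2 * (cmod L)\<^sup>2 * d" for r :: real
  proof -
    \<comment> \<open>The coefficient \<open>- r * L\<close> has the phase that makes both cross
      terms equal to \<open>- r\<close> times the squared modulus of \<open>L\<close>.\<close>
    have "0 \<le> Re (kernel_form K (Suc n) (x(n := z)) (c(n := - of_real r * L)))"
      by (rule positive_kernelD[OF assms])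
    also have "\<dots> = Q - 2 * r * (cmod L)\<^sup>2 + r\<^sup>2 * (cmod L)\<^sup>2 * d"
      unfolding kernel_form_extend[OF assms] L_def[symmetric] d
      unfolding Q_def cmod_power2 by (simp add: power2_eq_square algebra_simps)
    finally show ?thesis .
  qed
  have "(cmod L)\<^sup>2 \<le> d * Q"
  proof (cases "d = 0")
    case True
    have "cmod L = 0"
    proof (rule ccontr)
      assume "cmod L \<noteq> 0"
      \<comment> \<open>For \<open>d = 0\<close> the bound is affine in \<open>r\<close>, and this
        \<open>r\<close> gives it the value -1.\<close>
      then show False using ge[of "(Q + 1) / (2 * (cmod L)\<^sup>2)"] True by simp
    qed
    then show ?thesis using True by simp
  next
    case False
    then have "d > 0" using d by simp
    \<comment> \<open>The value \<open>r = 1 / d\<close> minimises the quadratic polynomial in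
      \<open>ge\<close>.\<close>
    have "0 \<le> Q - (cmod L)\<^sup>2 / d"
      using ge[of "1 / d"] \<open>d > 0\<close> by (simp add: power2_eq_square field_simps)
    then show ?thesis using \<open>d > 0\<close> by (simp add: field_simps)
  qed
  then show ?thesis by (simp add: L_def d_def Q_def)
qed

lemma positive_kernel_eq_0:
  assumes "positive_kernel K" "\<And>x. K x x = 0"
  shows "K x y = 0"
  using positive_kernel_cauchy_schwarz[OF assms(1), where n = 1 and c = "\<lambda>_. 1" and z = x
      and x = "\<lambda>_. y"] assms(2) by simp

text \<open>A maximal orthonormal family need not be total in the (incomplete) space spanned by the
  kernel functions. Zorn's lemma is therefore applied to families that may be subtracted from
  the kernel. Indices carry a natural number because a function may have to occur repeatedly.\<close>

theorem positive_kernel_decomposition: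
  fixes K :: "'x \<Rightarrow> 'x \<Rightarrow> complex"
  assumes K: "positive_kernel K"
  shows "\<exists>S :: (nat \<times> ('x \<Rightarrow> complex)) set.
    (\<forall>x y. ((\<lambda>p. cnj (snd p x) * snd p y) has_sum K x y) S) \<and>
    (\<forall>p\<in>S. \<forall>n x c. (cmod (\<Sum>i<n. c i * snd p (x i)))\<^sup>2 \<le> Re (kernel_form K n x c))"
proof -
  define L where "L p n x c = (cmod (\<Sum>i<n. c i * snd p (x i)))\<^sup>2"
    for p :: "nat \<times> ('x \<Rightarrow> complex)" and n :: nat and x :: "nat \<Rightarrow> 'x" and c
  \<comment> \<open>Only finite subfamilies are tested, so the condition passes to unions of chains,
    as Zorn's lemma requires.\<close>
  define P where "P = {S. \<forall>G\<subseteq>S. finite G \<longrightarrow>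
    (\<forall>n x c. (\<Sum>p\<in>G. L p n x c) \<le> Re (kernel_form K n x c))}"
  have L0: "0 \<le> L p n x c" for p n x c by (simp add: L_def)
  have "\<exists>S\<in>P. \<forall>X\<in>P. S \<subseteq> X \<longrightarrow> X = S"
  proof (rule subset_Zorn_nonempty)
    have "{} \<in> P"
      using K by (auto simp: P_def positive_kernel_def complex_nonneg_Reals_iff)
    then show "P \<noteq> {}" by blast
    show "\<Union>C \<in> P" if C: "C \<noteq> {}" "subset.chain P C" for C
      unfolding P_def
    proof (intro CollectI allI impI)
      fix G n x c assume G: "G \<subseteq> \<Union>C" "finite G"
      then obtain B where "B \<in> C" "G \<subseteq> B"
        using finite_subset_Union_chain[OF G(2,1) C] by blast
      moreover have "B \<in> P" using C(2) \<open>B \<in> C\<close> by (auto simp: subset.chain_def)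
      ultimately show "(\<Sum>p\<in>G. L p n x c) \<le> Re (kernel_form K n x c)"
        using G(2) by (auto simp: P_def)
    qed
  qed
  then obtain S where S: "S \<in> P" and max: "\<And>X. X \<in> P \<Longrightarrow> S \<subseteq> X \<Longrightarrow> X = S" by blast
  have fin: "(\<Sum>p\<in>G. L p n x c) \<le> Re (kernel_form K n x c)" if "G \<subseteq> S" "finite G" for G n x c
    using S that by (auto simp: P_def)
  have Lsum: "(\<lambda>p. L p n x c) summable_on S" for n x c
    by (rule nonneg_bdd_above_summable_on) (use fin L0 in \<open>auto intro!: bdd_aboveI\<close>)
  have Linf: "(\<Sum>\<^sub>\<infinity>p\<in>S. L p n x c) \<le> Re (kernel_form K n x c)" for n x c
    by (rule infsum_le_finite_sums[OF Lsum]) (use fin in auto)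
  have sq: "(\<lambda>p. (cmod (snd p x))\<^sup>2) summable_on S" for x
    using Lsum[of 1 "\<lambda>_. x" "\<lambda>_. 1"] by (simp add: L_def)
  have prod: "(\<lambda>p. cnj (snd p x) * snd p y) summable_on S" for x y
  proof (rule abs_summable_summable, rule Infinite_Sum.abs_summable_on_comparison_test')
    show "(\<lambda>p. (cmod (snd p x))\<^sup>2 + (cmod (snd p y))\<^sup>2) summable_on S"
      by (intro summable_on_add sq)
    show "cmod (cnj (snd p x) * snd p y) \<le> (cmod (snd p x))\<^sup>2 + (cmod (snd p y))\<^sup>2" for p
    proof -
      have "0 \<le> cmod (snd p x) * cmod (snd p y)" by simp
      then show ?thesis
        using sum_squares_bound[of "cmod (snd p x)" "cmod (snd p y)"]
        unfolding norm_mult complex_mod_cnj by linarith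
    qed
  qed
  define T where "T x y = (\<Sum>\<^sub>\<infinity>p\<in>S. cnj (snd p x) * snd p y)" for x y
  have T: "((\<lambda>p. cnj (snd p x) * snd p y) has_sum T x y) S" for x y
    unfolding T_def using prod by (rule has_sum_infsum)
  have formT: "((\<lambda>p. of_real (L p n x c)) has_sum kernel_form T n x c) S" for n x c
  proof -
    have "of_real (L p n x c) = (\<Sum>i<n. \<Sum>j<n. cnj (c i) * c j * (cnj (snd p (x i)) * snd p (x j)))"
      for p
    proof -
      have "of_real (L p n x c) = cnj (\<Sum>i<n. c i * snd p (x i)) * (\<Sum>j<n. c j * snd p (x j))"
        unfolding L_def complex_norm_square by (rule mult.commute)
      also have "\<dots> = (\<Sum>i<n. \<Sum>j<n. cnj (c i * snd p (x i)) * (c j * snd p (x j)))"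
        unfolding cnj_sum by (rule sum_product)
      finally show ?thesis by (simp add: mult_ac)
    qed
    then show ?thesis
      unfolding kernel_form_def
      by (simp only:) (intro has_sum_sum has_sum_cmult_right T)
  qed
  then have formT': "kernel_form T n x c = of_real (\<Sum>\<^sub>\<infinity>p\<in>S. L p n x c)" for n x c
    by (metis Lsum has_sum_infsum has_sum_of_real has_sum_unique)
  define R where "R x y = K x y - T x y" for x y
  have formR: "kernel_form R n x c = kernel_form K n x c - of_real (\<Sum>\<^sub>\<infinity>p\<in>S. L p n x c)" for n x c
    unfolding formT'[symmetric]
    by (simp add: R_def kernel_form_def algebra_simps sum_subtractf)
  \<comment> \<open>The domination of finite subsums survives in the infinite sum, so what remains
    after subtracting all of \<open>S\<close> is still positive.\<close>
  have R: "positive_kernel R"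
    unfolding positive_kernel_def
  proof (intro allI)
    fix n x c
    have "kernel_form K n x c \<in> \<real>\<^sub>\<ge>\<^sub>0" using K by (auto simp: positive_kernel_def)
    with Linf[of n x c] show "kernel_form R n x c \<in> \<real>\<^sub>\<ge>\<^sub>0"
      by (simp add: formR complex_nonneg_Reals_iff)
  qed
  have "R z z = 0" for z
  proof (rule ccontr)
    assume nz: "R z z \<noteq> 0"
    define d where "d = Re (R z z)"
    have d: "d > 0"
      using positive_kernel_diag[OF R, of z] nz by (auto simp: d_def complex_eq_iff)
    \<comment> \<open>The kernel function of the remainder at \<open>z\<close>, normalised so that
      by Cauchy-Schwarz it can be subtracted from \<open>R\<close>, while its squared modulus at
      \<open>z\<close> is \<open>d\<close>.\<close>
    define f where "f y = R z y / of_real (sqrt d)" for y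
    have Lf: "L (m, f) n x c \<le> Re (kernel_form R n x c)" for m n x c
    proof -
      have "L (m, f) n x c = (cmod ((\<Sum>j<n. c j * R z (x j)) / of_real (sqrt d)))\<^sup>2"
        by (simp add: L_def f_def sum_divide_distrib)
      also have "\<dots> = (cmod (\<Sum>j<n. c j * R z (x j)))\<^sup>2 / d"
        using d by (simp add: norm_divide power_divide)
      also have "\<dots> \<le> Re (kernel_form R n x c)"
        using positive_kernel_cauchy_schwarz[OF R, of c z x n] d
        by (simp add: d_def field_simps)
      finally show ?thesis .
    qed
    \<comment> \<open>Maximality alone would be no contradiction, since \<open>(m, f)\<close> might
      belong to \<open>S\<close> already. It shows instead that \<open>S\<close> contains
      \<open>f\<close> under every label \<open>m\<close>.\<close>
    have mem: "(m, f) \<in> S" for m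
    proof -
      have "insert (m, f) S \<in> P"
        unfolding P_def
      proof (intro CollectI allI impI)
        fix G n x c assume G: "G \<subseteq> insert (m, f) S" "finite G"
        have "(\<Sum>p\<in>G. L p n x c) \<le> (\<Sum>p\<in>insert (m, f) (G - {(m, f)}). L p n x c)"
          by (rule sum_mono2) (use G L0 in auto)
        also have "\<dots> = L (m, f) n x c + (\<Sum>p\<in>G - {(m, f)}. L p n x c)"
          by (rule sum.insert) (use G in auto)
        also have "(\<Sum>p\<in>G - {(m, f)}. L p n x c) \<le> (\<Sum>\<^sub>\<infinity>p\<in>S. L p n x c)"
          by (rule finite_sum_le_infsum[OF Lsum]) (use G L0 in auto)
        finally show "(\<Sum>p\<in>G. L p n x c) \<le> Re (kernel_form K n x c)"
          using Lf[of m n x c] by (simp add: formR)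
      qed
      then show ?thesis using max by blast
    qed
    \<comment> \<open>Each copy of \<open>f\<close> contributes \<open>d\<close> at the point
      \<open>z\<close>, so \<open>N\<close> copies exceed the finite value of \<open>K\<close>
      there.\<close>
    obtain N :: nat where N: "Re (K z z) < real N * d"
      using reals_Archimedean3[OF d] by blast
    have "real N * d = (\<Sum>p\<in>(\<lambda>m. (m, f)) ` {..<N}. L p 1 (\<lambda>_. z) (\<lambda>_. 1))"
    proof -
      have Rz: "R z z = of_real d"
        using positive_kernel_diag[OF R, of z] by (simp add: d_def complex_eq_iff)
      have "(cmod (f z))\<^sup>2 = d"
        using d by (simp add: f_def Rz norm_divide power_divide power2_eq_square)
      then show ?thesis by (subst sum.reindex) (auto simp: inj_on_def L_def)
    qed
    also have "\<dots> \<le> Re (kernel_form K 1 (\<lambda>_. z) (\<lambda>_. 1))"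
      by (rule fin) (use mem in auto)
    finally show False using N by (simp add: kernel_form_def)
  qed
  then have "R x y = 0" for x y by (rule positive_kernel_eq_0[OF R])
  then have "T = K" by (intro ext) (simp add: R_def)
  show ?thesis
  proof (intro exI[of _ S] conjI allI ballI)
    show "((\<lambda>p. cnj (snd p x) * snd p y) has_sum K x y) S" for x y
      using T \<open>T = K\<close> by simp
    show "(cmod (\<Sum>i<n. c i * snd p (x i)))\<^sup>2 \<le> Re (kernel_form K n x c)" if "p \<in> S" for p n x c
      using fin[of "{p}" n x c] that by (simp add: L_def)
  qed
qed


section \<open>The ultraweak topology\<close>

lemma topspace_ultraweak [simp]:
  "topspace (ultraweak_topology :: 'h :: complex_hilbert bop topology) = UNIV"
proof -
  have "UNIV \<in> {{T :: 'h bop. (\<Sum>n. cinner (\<xi> n) (T (\<eta> n))) \<in> U} | \<xi> \<eta> U.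
      summable (\<lambda>n. (norm (\<xi> n))\<^sup>2) \<and> summable (\<lambda>n. (norm (\<eta> n))\<^sup>2) \<and> open U}"
    by (intro CollectI exI[of _ "\<lambda>_. 0"] exI[of _ UNIV]) simp
  from Union_upper[OF this] show ?thesis
    unfolding ultraweak_topology_def topology_generated_by_topspace by (rule top.extremum_uniqueI)
qed

lemma summable_bop_apply:
  fixes T :: "'h :: complex_hilbert bop"
  assumes "summable (\<lambda>n. (norm (\<eta> n))\<^sup>2)"
  shows "summable (\<lambda>n. (norm (T (\<eta> n)))\<^sup>2)"
proof (rule summable_comparison_test')
  show "summable (\<lambda>n. (norm T)\<^sup>2 * (norm (\<eta> n))\<^sup>2)"
    by (intro summable_mult assms)
  show "norm ((norm (T (\<eta> n)))\<^sup>2) \<le> (norm T)\<^sup>2 * (norm (\<eta> n))\<^sup>2" for n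
    using power_mono[OF norm_bop_apply[of T "\<eta> n"], of 2] by (simp add: power_mult_distrib)
qed

lemma summable_norm_times_norm:
  assumes "summable (\<lambda>n. (norm (\<xi> n :: 'a :: real_normed_vector))\<^sup>2)"
    and "summable (\<lambda>n. (norm (\<eta> n :: 'b :: real_normed_vector))\<^sup>2)"
  shows "summable (\<lambda>n. norm (\<xi> n) * norm (\<eta> n))"
proof (rule summable_comparison_test')
  show "summable (\<lambda>n. (norm (\<xi> n))\<^sup>2 + (norm (\<eta> n))\<^sup>2)"
    by (intro summable_add assms)
  show "norm (norm (\<xi> n) * norm (\<eta> n)) \<le> (norm (\<xi> n))\<^sup>2 + (norm (\<eta> n))\<^sup>2" for n
  proof -
    have "0 \<le> norm (\<xi> n) * norm (\<eta> n)" by simp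
    then show ?thesis
      using sum_squares_bound[of "norm (\<xi> n)" "norm (\<eta> n)"]
      unfolding real_norm_def by linarith
  qed
qed

text \<open>The topology is generated by preimages under these functionals; induction over the
  generation of an open set reduces convergence to them.\<close>

lemma limitin_ultraweakI:
  fixes T :: "'i \<Rightarrow> 'h :: complex_hilbert bop" and L :: "'h bop"
  assumes "\<And>\<xi> \<eta>. summable (\<lambda>n. (norm (\<xi> n))\<^sup>2) \<Longrightarrow> summable (\<lambda>n. (norm (\<eta> n))\<^sup>2) \<Longrightarrow>
    ((\<lambda>i. \<Sum>n. cinner (\<xi> n) (T i (\<eta> n))) \<longlongrightarrow> (\<Sum>n. cinner (\<xi> n) (L (\<eta> n)))) F"
  shows "limitin ultraweak_topology T L F"
  unfolding limitin_def
proof (intro conjI allI impI)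
  show "L \<in> topspace ultraweak_topology" by simp
  fix U assume U: "openin ultraweak_topology U \<and> L \<in> U"
  then have "generate_topology_on {{T :: 'h bop. (\<Sum>n. cinner (\<xi> n) (T (\<eta> n))) \<in> U} | \<xi> \<eta> U.
      summable (\<lambda>n. (norm (\<xi> n))\<^sup>2) \<and> summable (\<lambda>n. (norm (\<eta> n))\<^sup>2) \<and> open U} U"
    by (simp add: ultraweak_topology_def openin_topology_generated_by_iff)
  moreover have "L \<in> U" using U by blast
  ultimately show "\<forall>\<^sub>F i in F. T i \<in> U"
  proof induction
    case (Int a b)
    then show ?case by (simp add: eventually_conj)
  next
    case (UN K)
    then obtain k where "k \<in> K" "L \<in> k" by blast
    with UN have "\<forall>\<^sub>F i in F. T i \<in> k" by blast
    then show ?case by (rule eventually_mono) (use \<open>k \<in> K\<close> in blast)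
  next
    case (Basis s)
    then obtain \<xi> \<eta> V where s: "s = {T :: 'h bop. (\<Sum>n. cinner (\<xi> n) (T (\<eta> n))) \<in> V}"
      "summable (\<lambda>n. (norm (\<xi> n))\<^sup>2)" "summable (\<lambda>n. (norm (\<eta> n))\<^sup>2)" "open V"
      by blast
    then show ?case using assms[of \<xi> \<eta>] Basis.prems by (auto dest: topological_tendstoD)
  qed simp
qed

text \<open>For uniformly bounded families weak convergence is already ultraweak: Tannery's theorem
  exchanges limit and series, with the majorant
  \<open>C * (norm (\<xi> n) * norm (\<eta> n))\<close>.\<close>

lemma limitin_ultraweak_bounded:
  fixes T :: "'i \<Rightarrow> 'h :: complex_hilbert bop" and L :: "'h bop"
  assumes weak: "\<And>v w. ((\<lambda>i. cinner v (T i w)) \<longlongrightarrow> cinner v (L w)) F"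
    and bound: "\<And>i v w. cmod (cinner v (T i w)) \<le> C * (norm v * norm w)"
    and "F \<noteq> bot"
  shows "limitin ultraweak_topology T L F"
proof (rule limitin_ultraweakI)
  fix \<xi> \<eta> :: "nat \<Rightarrow> 'h"
  assume "summable (\<lambda>n. (norm (\<xi> n))\<^sup>2)" "summable (\<lambda>n. (norm (\<eta> n))\<^sup>2)"
  then have "summable (\<lambda>n. C * (norm (\<xi> n) * norm (\<eta> n)))"
    by (rule summable_mult[OF summable_norm_times_norm])
  note sum = this
  have "\<forall>\<^sub>F (n, i) in at_top \<times>\<^sub>F F. cmod (cinner (\<xi> n) (T i (\<eta> n))) \<le> C * (norm (\<xi> n) * norm (\<eta> n))"
    by (rule always_eventually) (use bound in \<open>simp only: split_paired_All prod.case simp_thms\<close>)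
  from tannerys_theorem[OF weak this sum \<open>F \<noteq> bot\<close>, THEN conjunct2, THEN conjunct2]
  show "((\<lambda>i. \<Sum>n. cinner (\<xi> n) (T i (\<eta> n))) \<longlongrightarrow> (\<Sum>n. cinner (\<xi> n) (L (\<eta> n)))) F" .
qed

text \<open>A subbasic set pulls back to a subbasic set, with the vectors \<open>\<xi> n\<close> and
  \<open>\<eta> n\<close> replaced by \<open>adj S (\<xi> n)\<close> and
  \<open>T (\<eta> n)\<close>.\<close>

lemma continuous_map_ultraweak_times:
  fixes S T :: "'h :: complex_hilbert bop"
  shows "continuous_map ultraweak_topology ultraweak_topology (\<lambda>x. S * x * T)"
proof -
  define B where "B = {{T :: 'h bop. (\<Sum>n. cinner (\<xi> n) (T (\<eta> n))) \<in> U} | \<xi> \<eta> U.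
      summable (\<lambda>n. (norm (\<xi> n))\<^sup>2) \<and> summable (\<lambda>n. (norm (\<eta> n))\<^sup>2) \<and> open U}"
  have B: "ultraweak_topology = topology_generated_by B"
    by (simp add: ultraweak_topology_def B_def)
  have "continuous_map ultraweak_topology (topology_generated_by B) (\<lambda>x. S * x * T)"
  proof (rule continuous_on_generated_topo)
    show "(\<lambda>x. S * x * T) ` topspace ultraweak_topology \<subseteq> \<Union> B"
      using topspace_ultraweak[where 'h = 'h]
      unfolding B topology_generated_by_topspace by simp
    fix U assume "U \<in> B"
    then obtain \<xi> \<eta> V where U: "U = {T :: 'h bop. (\<Sum>n. cinner (\<xi> n) (T (\<eta> n))) \<in> V}"
      "summable (\<lambda>n. (norm (\<xi> n))\<^sup>2)" "summable (\<lambda>n. (norm (\<eta> n))\<^sup>2)" "open V"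
      unfolding B_def by blast
    have "(\<lambda>x. S * x * T) -` U \<inter> topspace ultraweak_topology
        = {x :: 'h bop. (\<Sum>n. cinner (adj S (\<xi> n)) (x (T (\<eta> n)))) \<in> V}"
      by (auto simp: U times_bop_apply cinner_adj)
    also have "\<dots> \<in> B"
      unfolding B_def
      by (intro CollectI exI[of _ "\<lambda>n. adj S (\<xi> n)"] exI[of _ "\<lambda>n. T (\<eta> n)"] exI[of _ V])
         (simp add: U(4) summable_bop_apply[OF U(2)] summable_bop_apply[OF U(3)])
    finally show "openin ultraweak_topology ((\<lambda>x. S * x * T) -` U \<inter> topspace ultraweak_topology)"
      unfolding B by (rule topology_generated_by_Basis)
  qed
  then show ?thesis by (simp add: B)
qed

text \<open>An ultraweak functional is determined by finitely many vectors up to a small tail of its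
  series, and a finite rank projection can fix those vectors exactly.\<close>

lemma ultraweak_nbhd_one_contains_proj:
  fixes U :: "'h :: complex_hilbert bop set"
  assumes U: "openin ultraweak_topology U" "1 \<in> U"
  obtains E where "finite E" "orthonormal E" "proj E \<in> U"
proof -
  have "generate_topology_on {{T :: 'h bop. (\<Sum>n. cinner (\<xi> n) (T (\<eta> n))) \<in> U} | \<xi> \<eta> U.
      summable (\<lambda>n. (norm (\<xi> n))\<^sup>2) \<and> summable (\<lambda>n. (norm (\<eta> n))\<^sup>2) \<and> open U} U"
    using U by (simp add: ultraweak_topology_def openin_topology_generated_by_iff)
  \<comment> \<open>The induction needs a claim about all projections fixing a finite set
    \<open>B\<close>: for an intersection of two open sets the two finite sets are simply
    united.\<close>
  from this U(2) have "\<exists>B. finite B \<and>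
    (\<forall>E. finite E \<longrightarrow> orthonormal E \<longrightarrow> (\<forall>b\<in>B. proj E b = b) \<longrightarrow> proj E \<in> U)"
  proof induction
    case (Int a b)
    then obtain A B where "finite A" "finite B"
      "\<forall>E. finite E \<longrightarrow> orthonormal E \<longrightarrow> (\<forall>b\<in>A. proj E b = b) \<longrightarrow> proj E \<in> a"
      "\<forall>E. finite E \<longrightarrow> orthonormal E \<longrightarrow> (\<forall>b\<in>B. proj E b = b) \<longrightarrow> proj E \<in> b"
      by blast
    then show ?case by (intro exI[of _ "A \<union> B"]) auto
  next
    case (UN K)
    then obtain k where "k \<in> K" "1 \<in> k" by blast
    with UN.IH show ?case by (meson UnionI)
  next
    case (Basis s)
    then obtain \<xi> \<eta> V where s: "s = {T :: 'h bop. (\<Sum>n. cinner (\<xi> n) (T (\<eta> n))) \<in> V}"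
      and sq: "summable (\<lambda>n. (norm (\<xi> n))\<^sup>2)" "summable (\<lambda>n. (norm (\<eta> n))\<^sup>2)" and V: "open V"
      by blast
    define l where "l = (\<Sum>n. cinner (\<xi> n) (\<eta> n))"
    define m where "m n = norm (\<xi> n) * norm (\<eta> n)" for n
    have m: "summable m" unfolding m_def using sq by (rule summable_norm_times_norm)
    have "l \<in> V" using Basis.prems by (simp add: s l_def one_bop_apply)
    then obtain \<epsilon> where \<epsilon>: "\<epsilon> > 0" "ball l \<epsilon> \<subseteq> V" using V by (meson openE)
    obtain N where N: "norm (\<Sum>i. m (i + N)) < \<epsilon>"
      using suminf_exist_split[OF \<epsilon>(1) m] by blast
    have "proj E \<in> s"
      if E: "finite E" "orthonormal E" "\<forall>b\<in>\<xi> ` {..<N}. proj E b = b" for E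
    proof -
      have 1: "summable (\<lambda>n. cinner (\<xi> n) (\<eta> n))"
        by (rule summable_comparison_test'[OF m]) (simp add: m_def cauchy_schwarz)
      have 2: "summable (\<lambda>n. cinner (\<xi> n) (proj E (\<eta> n)))"
      proof (rule summable_comparison_test'[OF m])
        show "cmod (cinner (\<xi> n) (proj E (\<eta> n))) \<le> m n" for n
          using cauchy_schwarz[of "\<xi> n" "proj E (\<eta> n)"]
            mult_left_mono[OF norm_proj_le[OF E(1,2), of "\<eta> n"], of "norm (\<xi> n)"]
          by (simp add: m_def)
      qed
      define a where "a n = cinner (\<xi> n) (\<eta> n) - cinner (\<xi> n) (proj E (\<eta> n))" for n
      \<comment> \<open>Self-adjointness moves the defect \<open>1 - proj E\<close> onto
        \<open>\<xi> n\<close>, where it vanishes for \<open>n < N\<close>; only the tail of the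
        series is left.\<close>
      have a: "a n = cinner (\<xi> n - proj E (\<xi> n)) (\<eta> n)" for n
        by (simp add: a_def cinner_diff_left flip: cinner_adj)
      have "summable a" unfolding a_def by (intro summable_diff 1 2)
      have "l - (\<Sum>n. cinner (\<xi> n) (proj E (\<eta> n))) = suminf a"
        unfolding l_def a_def by (rule suminf_diff[OF 1 2])
      also have "\<dots> = (\<Sum>n. a (n + N))"
        using suminf_split_initial_segment[OF \<open>summable a\<close>, of N] E(3) by (simp add: a)
      also have "cmod \<dots> \<le> (\<Sum>n. m (n + N))"
      proof (rule norm_suminf_le)
        show "cmod (a (n + N)) \<le> m (n + N)" for n
          unfolding a m_def
          using cauchy_schwarz[of "\<xi> (n + N) - proj E (\<xi> (n + N))" "\<eta> (n + N)"]
            mult_right_mono[OF norm_diff_proj_le[OF E(1,2), of "\<xi> (n + N)"], of "norm (\<eta> (n + N))"]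
          by simp
        show "summable (\<lambda>n. m (n + N))" using m by (simp add: summable_iff_shift)
      qed
      finally have "(\<Sum>n. cinner (\<xi> n) (proj E (\<eta> n))) \<in> ball l \<epsilon>"
        using N by (simp add: dist_norm)
      then show ?thesis using \<epsilon>(2) by (auto simp: s)
    qed
    then show ?case by (intro exI[of _ "\<xi> ` {..<N}"]) simp
  qed simp
  then obtain B where "finite B" and
    B: "\<And>E. finite E \<Longrightarrow> orthonormal E \<Longrightarrow> \<forall>b\<in>B. proj E b = b \<Longrightarrow> proj E \<in> U"
    by blast
  obtain E where "finite E" "orthonormal E" "\<forall>b\<in>B. proj E b = b"
    using exists_proj_fixing[OF \<open>finite B\<close>] by blast
  then show ?thesis using B that by blast
qed


section \<open>Kraus decompositions of normal unital completely positive maps\<close>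

lemma completely_positive_add:
  "completely_positive \<Phi> \<Longrightarrow> \<Phi> (x + y) = \<Phi> x + \<Phi> y"
  by (simp add: completely_positive_def)

lemma completely_positive_scaleC:
  "completely_positive \<Phi> \<Longrightarrow> \<Phi> (c *\<^sub>C x) = c *\<^sub>C \<Phi> x"
  by (simp add: completely_positive_def)

lemma completely_positive_diff:
  assumes "completely_positive \<Phi>"
  shows "\<Phi> (x - y) = \<Phi> x - \<Phi> y"
  by (metis assms completely_positive_add add_diff_cancel diff_add_cancel)

lemma completely_positive_sum:
  assumes "completely_positive \<Phi>"
  shows "\<Phi> (\<Sum>i\<in>I. f i) = (\<Sum>i\<in>I. \<Phi> (f i))"
proof -
  have "\<Phi> 0 = 0" using completely_positive_diff[OF assms, of 0 0] by simp
  then show ?thesis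
    by (induction I rule: infinite_finite_induct) (simp_all add: completely_positive_add[OF assms])
qed

lemma completely_positive_imp_positive:
  fixes T :: "'h :: complex_hilbert bop"
  assumes "completely_positive \<Phi>" "\<And>x. cinner x (T x) \<in> \<real>\<^sub>\<ge>\<^sub>0"
  shows "cinner h (\<Phi> T h) \<in> \<real>\<^sub>\<ge>\<^sub>0"
proof -
  have "matrix_positive 1 (\<lambda>_ _. T)"
    using assms(2) by (simp add: matrix_positive_def)
  then have "matrix_positive 1 (\<lambda>_ _. \<Phi> T)"
    using assms(1) unfolding completely_positive_def by blast
  then show ?thesis
    unfolding matrix_positive_def by (auto dest: spec[of _ "\<lambda>_. h"])
qed

definition channel_kernel ::
  "('h :: complex_hilbert bop \<Rightarrow> 'h bop) \<Rightarrow> 'h \<times> 'h \<Rightarrow> 'h \<times> 'h \<Rightarrow> complex"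
  where "channel_kernel \<Phi> a b = cinner (snd a) (\<Phi> (ketbra (fst a) (fst b)) (snd b))"

text \<open>The matrix with entries |v i\<rangle>\<langle>v j| is positive, its quadratic form being
  a squared modulus. Complete positivity transfers this to \<Phi>, and the coefficients
  \<open>c i\<close> are absorbed into the vectors.\<close>

lemma positive_channel_kernel:
  fixes \<Phi> :: "'h :: complex_hilbert bop \<Rightarrow> 'h bop"
  assumes "completely_positive \<Phi>"
  shows "positive_kernel (channel_kernel \<Phi>)"
  unfolding positive_kernel_def
proof (intro allI)
  fix n and x :: "nat \<Rightarrow> 'h \<times> 'h" and c :: "nat \<Rightarrow> complex"
  define v where "v i = fst (x i)" for i
  have "matrix_positive n (\<lambda>i j. ketbra (v i) (v j))"
    unfolding matrix_positive_def
  proof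
    fix \<xi> :: "nat \<Rightarrow> 'h"
    have "(\<Sum>i<n. cinner (\<xi> i) (\<Sum>j<n. ketbra (v i) (v j) (\<xi> j)))
        = (\<Sum>i<n. cnj (cinner (v i) (\<xi> i)) * (\<Sum>j<n. cinner (v j) (\<xi> j)))"
      by (simp add: ketbra_apply cinner_scaleC_right mult.commute cinner_commute[of "\<xi> _" "v _"]
          flip: scaleC_sum_left)
    also have "\<dots> = of_real ((cmod (\<Sum>j<n. cinner (v j) (\<xi> j)))\<^sup>2)"
      unfolding complex_norm_square cnj_sum sum_distrib_right[symmetric] by (rule mult.commute)
    finally show "(\<Sum>i<n. cinner (\<xi> i) (\<Sum>j<n. ketbra (v i) (v j) (\<xi> j))) \<in> \<real>\<^sub>\<ge>\<^sub>0"
      by simp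
  qed
  then have pos: "matrix_positive n (\<lambda>i j. \<Phi> (ketbra (v i) (v j)))"
    using assms unfolding completely_positive_def by blast
  have "kernel_form (channel_kernel \<Phi>) n x c
      = (\<Sum>i<n. cinner (c i *\<^sub>C snd (x i)) (\<Sum>j<n. \<Phi> (ketbra (v i) (v j)) (c j *\<^sub>C snd (x j))))"
    by (simp add: kernel_form_def channel_kernel_def v_def cinner_sum_right cinner_scaleC_left
        cinner_scaleC_right bop_scaleC_right sum_distrib_left mult.assoc mult.left_commute)
  also have "\<dots> \<in> \<real>\<^sub>\<ge>\<^sub>0"
    using pos[unfolded matrix_positive_def, rule_format, of "\<lambda>i. c i *\<^sub>C snd (x i)"] .
  finally show "kernel_form (channel_kernel \<Phi>) n x c \<in> \<real>\<^sub>\<ge>\<^sub>0" .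
qed

text \<open>With \<open>h\<close> frozen the form sees only one combined vector, so it vanishes on
  linear relations among the \<open>v i\<close>. The coefficients are conjugated because the first
  slot of the kernel will carry an antilinear function.\<close>

lemma channel_kernel_form_left:
  fixes h :: "'h :: complex_hilbert"
  assumes "completely_positive \<Phi>"
  defines "u \<equiv> (\<lambda>n c v. \<Sum>i<n. cnj (c i) *\<^sub>C v i)"
  shows "kernel_form (channel_kernel \<Phi>) n (\<lambda>i. (v i, h)) c
    = cinner h (\<Phi> (ketbra (u n c v) (u n c v)) h)"
  by (simp add: kernel_form_def channel_kernel_def u_def ketbra_sum_left ketbra_sum_right
      ketbra_scaleC_left ketbra_scaleC_right completely_positive_sum[OF assms(1)]
      completely_positive_scaleC[OF assms(1)] bop_sum_apply scaleC_bop_apply cinner_sum_right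
      cinner_scaleC_right mult.assoc sum_distrib_left)
     (subst sum.swap, simp add: mult.left_commute)

lemma channel_kernel_form_right:
  fixes v :: "'h :: complex_hilbert"
  defines "g \<equiv> (\<lambda>n c h. \<Sum>i<n. c i *\<^sub>C h i)"
  shows "kernel_form (channel_kernel \<Phi>) n (\<lambda>i. (v, h i)) c
    = cinner (g n c h) (\<Phi> (ketbra v v) (g n c h))"
  by (simp add: kernel_form_def channel_kernel_def g_def bop_sum_right bop_scaleC_right
      cinner_sum_right cinner_sum_left cinner_scaleC_right cinner_scaleC_left mult.assoc
      sum_distrib_left) (subst sum.swap, simp add: mult.left_commute)

text \<open>By Cauchy-Schwarz the operator |v\<rangle>\<langle>v| lies below the square of
  \<open>norm v\<close> times 1; a positive unital map preserves this.\<close>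

lemma Re_cinner_ketbra_le:
  fixes v h :: "'h :: complex_hilbert"
  assumes "completely_positive \<Phi>" "\<Phi> 1 = 1"
  shows "Re (cinner h (\<Phi> (ketbra v v) h)) \<le> (norm v * norm h)\<^sup>2"
proof -
  define T where "T = complex_of_real ((norm v)\<^sup>2) *\<^sub>C 1 - ketbra v v"
  have "cinner h (\<Phi> T h) \<in> \<real>\<^sub>\<ge>\<^sub>0"
  proof (rule completely_positive_imp_positive[OF assms(1)])
    fix x
    have "cinner v x * cinner x v = of_real ((cmod (cinner v x))\<^sup>2)"
      unfolding complex_norm_square by (simp add: cinner_commute[of x v])
    then have "cinner x (T x) = of_real ((norm v * norm x)\<^sup>2 - (cmod (cinner v x))\<^sup>2)"
      by (simp add: T_def bop_diff_apply scaleC_bop_apply one_bop_apply ketbra_apply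
          cinner_diff_right cinner_scaleC_right cinner_self power_mult_distrib)
    then show "cinner x (T x) \<in> \<real>\<^sub>\<ge>\<^sub>0"
      using power_mono[OF cauchy_schwarz[of v x], of 2]
      by (simp del: of_real_diff of_real_power of_real_mult)
  qed
  moreover have "cinner h (\<Phi> T h) = of_real ((norm v * norm h)\<^sup>2) - cinner h (\<Phi> (ketbra v v) h)"
    by (simp add: T_def completely_positive_diff[OF assms(1)]
        completely_positive_scaleC[OF assms(1)] assms(2) bop_diff_apply scaleC_bop_apply
        one_bop_apply cinner_diff_right cinner_scaleC_right cinner_self power_mult_distrib)
  ultimately show ?thesis by (simp add: complex_nonneg_Reals_iff)
qed

text \<open>A function dominated by the kernel form vanishes on every linear relation on which the
  form vanishes. Hence each piece of the kernel is linear in \<open>h\<close> and antilinear in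
  \<open>v\<close>, and the form on a single point bounds it, so it equals
  \<open>cinner v (k p h)\<close> for an operator \<open>k p\<close>.\<close>

lemma kraus_on_ketbra:
  fixes \<Phi> :: "'h :: complex_hilbert bop \<Rightarrow> 'h bop"
  assumes cp: "completely_positive \<Phi>" and one: "\<Phi> 1 = 1"
  shows "\<exists>(S :: (nat \<times> ('h \<times> 'h \<Rightarrow> complex)) set) k. \<forall>v w h g.
    ((\<lambda>p. cinner (bop_apply (k p) h) (ketbra v w (k p g))) has_sum cinner h (\<Phi> (ketbra v w) g)) S"
proof -
  let ?K = "channel_kernel \<Phi>"
  obtain S :: "(nat \<times> ('h \<times> 'h \<Rightarrow> complex)) set" where S:
    "(\<forall>x y. ((\<lambda>p. cnj (snd p x) * snd p y) has_sum ?K x y) S) \<and>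
    (\<forall>p\<in>S. \<forall>n x c. (cmod (\<Sum>i<n. c i * snd p (x i)))\<^sup>2 \<le> Re (kernel_form ?K n x c))"
    using positive_kernel_decomposition[OF positive_channel_kernel[OF cp]] by (rule exE)
  note sum = S[THEN conjunct1, rule_format] and le = S[THEN conjunct2, rule_format]
  have right: "(\<Sum>i<n. c i * snd p (v, h i)) = 0"
    if "p \<in> S" "(\<Sum>i<n. c i *\<^sub>C h i) = 0" for p and n :: nat and c h v
    using le[OF that(1), where n = n and c = c and x = "\<lambda>i. (v, h i)"] that(2)
    by (simp add: channel_kernel_form_right)
  have left: "(\<Sum>i<n. c i * snd p (v i, h)) = 0"
    if "p \<in> S" "(\<Sum>i<n. cnj (c i) *\<^sub>C v i) = 0" for p and n :: nat and c h v
  proof -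
    have "\<Phi> 0 = 0" using completely_positive_diff[OF cp, of 0 0] by simp
    then show ?thesis
      using le[OF that(1), where n = n and c = c and x = "\<lambda>i. (v i, h)"] that(2)
      by (simp add: channel_kernel_form_left[OF cp])
  qed
  have "\<exists>T. \<forall>v h. cinner v (bop_apply T h) = snd p (v, h)" if p: "p \<in> S" for p
  proof (rule bop_of_form[where B = "\<lambda>v h. snd p (v, h)" and K = 1])
    note three = lessThan_Suc numeral_3_eq_3 numeral_2_eq_2 scaleC_add_left scaleC_add_right
    \<comment> \<open>Coefficients of the relation (w + w') - w - w' = 0, which encodes
      additivity.\<close>
    define c3 :: "nat \<Rightarrow> complex" where "c3 i = (if i = 0 then 1 else - 1)" for i
    have neg: "- 1 *\<^sub>C x = - x" for x :: 'h
      using scaleR_scaleC[of "- 1" x] by simp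
    show "snd p (v, w + w') = snd p (v, w) + snd p (v, w')" for v w w'
      using right[OF p, where n = 3 and c = c3 and v = v
          and h = "\<lambda>i. if i = 0 then w + w' else if i = 1 then w else w'"]
      by (simp add: three c3_def neg algebra_simps)
    show "snd p (v + v', w) = snd p (v, w) + snd p (v', w)" for v v' w
      using left[OF p, where n = 3 and c = c3 and h = w
          and v = "\<lambda>i. if i = 0 then v + v' else if i = 1 then v else v'"]
      by (simp add: three c3_def neg algebra_simps)
    show "snd p (v, c *\<^sub>C w) = c * snd p (v, w)" for v c w
      using right[OF p, where n = 2 and c = "\<lambda>i. if i = 0 then 1 else - c" and v = v
          and h = "\<lambda>i. if i = 0 then c *\<^sub>C w else w"]
      by (simp add: three flip: scaleC_add_left)
    \<comment> \<open>The left relation conjugates its coefficients, so \<open>- cnj c\<close> is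
      what makes \<open>c *\<^sub>C v\<close> and \<open>v\<close> cancel.\<close>
    show "snd p (c *\<^sub>C v, w) = cnj c * snd p (v, w)" for v c w
      using left[OF p, where n = 2 and c = "\<lambda>i. if i = 0 then 1 else - cnj c" and h = w
          and v = "\<lambda>i. if i = 0 then c *\<^sub>C v else v"]
      by (simp add: three flip: scaleC_add_left)
    show "cmod (snd p (v, w)) \<le> 1 * norm v * norm w" for v w
    proof -
      have "(cmod (snd p (v, w)))\<^sup>2 \<le> Re (cinner w (\<Phi> (ketbra v v) w))"
        using le[OF p, where n = 1 and c = "\<lambda>_. 1" and x = "\<lambda>_. (v, w)"]
        by (simp add: channel_kernel_form_right)
      also have "\<dots> \<le> (norm v * norm w)\<^sup>2" by (rule Re_cinner_ketbra_le[OF cp one])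
      finally have "cmod (snd p (v, w)) \<le> norm v * norm w"
        by (rule power2_le_imp_le) simp
      then show ?thesis by simp
    qed
  qed blast
  then have "\<forall>p\<in>S. \<exists>T. \<forall>v h. cinner v (bop_apply T h) = snd p (v, h)" by blast
  from bchoice[OF this] obtain k
    where k: "\<And>p v h. p \<in> S \<Longrightarrow> cinner v (bop_apply (k p) h) = snd p (v, h)"
    by blast
  show ?thesis
  proof (intro exI[of _ S] exI[of _ k] allI)
    fix v w h g :: 'h
    have eq: "cinner (k p h) (ketbra v w (k p g)) = cnj (snd p (v, h)) * snd p (w, g)"
      if "p \<in> S" for p
      by (simp add: ketbra_apply cinner_scaleC_right cinner_commute[of "k p h" v] k that)
    have "((\<lambda>p. cnj (snd p (v, h)) * snd p (w, g)) has_sum cinner h (\<Phi> (ketbra v w) g)) S"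
      using sum[of "(v, h)" "(w, g)"] by (simp add: channel_kernel_def)
    then show "((\<lambda>p. cinner (k p h) (ketbra v w (k p g))) has_sum cinner h (\<Phi> (ketbra v w) g)) S"
      by (rule has_sum_cong[THEN iffD2, rotated]) (rule eq)
  qed
qed


section \<open>From rank one operators to all operators by normality\<close>

lemma normal_ucp_near_proj:
  fixes \<Phi> :: "'h :: complex_hilbert bop \<Rightarrow> 'h bop"
  assumes "normal_ucp \<Phi>" "\<epsilon> > 0"
  obtains E where "finite E" "orthonormal E"
    "cmod (cinner h (\<Phi> (proj E) h) - cinner h h) < \<epsilon>"
    "cmod (cinner h (\<Phi> (proj E * x) g) - cinner h (\<Phi> x g)) < \<epsilon>"
proof -
  have \<Phi>: "continuous_map ultraweak_topology ultraweak_topology \<Phi>" "\<Phi> 1 = 1"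
    using assms(1) by (simp_all add: normal_ucp_def)
  \<comment> \<open>The factor 1 brings \<open>T * y\<close> into the two-sided form whose
    continuity is known.\<close>
  have cont: "continuous_map ultraweak_topology euclidean (\<lambda>T. cinner h (\<Phi> (1 * T * y) w))" for y w
  proof -
    have "continuous_map ultraweak_topology euclidean ((\<lambda>T :: 'h bop. cinner h (T w)) \<circ> (\<Phi> \<circ> (\<lambda>T. 1 * T * y)))"
      by (rule continuous_map_compose[OF continuous_map_compose[OF continuous_map_ultraweak_times \<Phi>(1)]
          continuous_map_ultraweak_cinner])
    then show ?thesis by (simp add: o_def)
  qed
  define U where "U y w = {T. cinner h (\<Phi> (1 * T * y) w) \<in> ball (cinner h (\<Phi> y w)) \<epsilon>}" for y w
  have U: "openin ultraweak_topology (U y w)" for y w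
    using openin_continuous_map_preimage[OF cont[of y w], of "ball (cinner h (\<Phi> y w)) \<epsilon>"]
    by (simp add: U_def)
  have "1 \<in> U 1 h \<inter> U x g" using assms(2) by (simp add: U_def)
  with openin_Int[OF U U] obtain E where "finite E" "orthonormal E" "proj E \<in> U 1 h \<inter> U x g"
    by (rule ultraweak_nbhd_one_contains_proj)
  then show ?thesis
    by (intro that[of E]) (simp_all add: U_def dist_norm norm_minus_commute \<Phi>(2) one_bop_apply)
qed

text \<open>The identity holds for \<open>proj E * x\<close>, a finite sum of rank one operators.
  Replacing \<open>x\<close> by it costs little on both sides: in \<Phi> by normality, and in the
  sum because the total mass of the vectors \<open>k p h - proj E (k p h)\<close> is small.\<close>

lemma has_sum_extend_from_ketbra:
  fixes \<Phi> :: "'h :: complex_hilbert bop \<Rightarrow> 'h bop" and k :: "'i \<Rightarrow> 'h bop"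
    and x :: "'h bop"
  assumes \<Phi>: "normal_ucp \<Phi>"
    and k: "\<And>v w h g. ((\<lambda>p. cinner (k p h) (ketbra v w (k p g)))
      has_sum cinner h (\<Phi> (ketbra v w) g)) S"
  shows "((\<lambda>p. cinner (k p h) (x (k p g))) has_sum cinner h (\<Phi> x g)) S"
proof -
  have cp: "completely_positive \<Phi>" and one: "\<Phi> 1 = 1"
    using \<Phi> by (simp_all add: normal_ucp_def)
  have proj_times: "proj E * y = (\<Sum>e\<in>E. ketbra e (adj y e))" for E and y :: "'h bop"
    by (simp add: proj_def sum_distrib_right ketbra_times)
  have fin: "((\<lambda>p. cinner (k p h) (proj E (y (k p g)))) has_sum cinner h (\<Phi> (proj E * y) g)) S"
    for E and y :: "'h bop" and h g
  proof -
    have "((\<lambda>p. \<Sum>e\<in>E. cinner (k p h) (ketbra e (adj y e) (k p g))) has_sum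
        (\<Sum>e\<in>E. cinner h (\<Phi> (ketbra e (adj y e)) g))) S"
      by (intro has_sum_sum k)
    moreover have "proj E (y z) = (\<Sum>e\<in>E. ketbra e (adj y e) z)" for z
      unfolding times_bop_apply[symmetric] proj_times bop_sum_apply ..
    ultimately show ?thesis
      by (simp add: proj_times completely_positive_sum[OF cp] bop_sum_apply cinner_sum_right)
  qed
  have fin_sq: "((\<lambda>p. (norm (proj E (k p h)))\<^sup>2) has_sum Re (cinner h (\<Phi> (proj E) h))) S"
    if E: "finite E" "orthonormal E" for E h
    using has_sum_Re[OF fin[of h E 1 h]]
    by (simp add: one_bop_apply cinner_proj_self[OF E])
  have le: "Re (cinner h (\<Phi> (proj E) h)) \<le> (norm h)\<^sup>2" if E: "finite E" "orthonormal E" for E h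
  proof -
    have "cinner h (\<Phi> (1 - proj E) h) \<in> \<real>\<^sub>\<ge>\<^sub>0"
    proof (rule completely_positive_imp_positive[OF cp])
      show "cinner x ((1 - proj E) x) \<in> \<real>\<^sub>\<ge>\<^sub>0" for x
        using norm_proj_le[OF E, of x]
        by (simp add: bop_diff_apply one_bop_apply cinner_diff_right cinner_self
            cinner_proj_self[OF E] flip: of_real_diff of_real_power)
    qed
    then show ?thesis
      by (simp add: completely_positive_diff[OF cp] one bop_diff_apply one_bop_apply
          cinner_diff_right cinner_self complex_nonneg_Reals_iff)
  qed
  \<comment> \<open>The case \<open>x = 1\<close>. The upper bound holds for each finite subsum, by
    a projection fixing the vectors in it; the lower bound is where normality enters.\<close>
  have sq: "((\<lambda>p. (norm (k p h))\<^sup>2) has_sum (norm h)\<^sup>2) S" for h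
  proof -
    have bound: "(\<Sum>p\<in>F. (norm (k p h))\<^sup>2) \<le> (norm h)\<^sup>2" if F: "finite F" "F \<subseteq> S" for F
    proof -
      obtain E where E: "finite E" "orthonormal E" "\<forall>b\<in>(\<lambda>p. k p h) ` F. proj E b = b"
        using exists_proj_fixing[of "(\<lambda>p. k p h) ` F"] F by blast
      have "(\<Sum>p\<in>F. (norm (k p h))\<^sup>2) = (\<Sum>p\<in>F. (norm (proj E (k p h)))\<^sup>2)"
        using E(3) by simp
      also have "\<dots> \<le> Re (cinner h (\<Phi> (proj E) h))"
        by (rule finite_sum_le_has_sum[OF fin_sq[OF E(1,2)]]) (use F in auto)
      also have "\<dots> \<le> (norm h)\<^sup>2" by (rule le[OF E(1,2)])
      finally show ?thesis .
    qed
    have "(\<lambda>p. (norm (k p h))\<^sup>2) summable_on S"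
      by (rule nonneg_bdd_above_summable_on) (use bound in \<open>auto intro!: bdd_aboveI\<close>)
    then have s: "((\<lambda>p. (norm (k p h))\<^sup>2) has_sum (\<Sum>\<^sub>\<infinity>p\<in>S. (norm (k p h))\<^sup>2)) S"
      by (rule has_sum_infsum)
    have "(\<Sum>\<^sub>\<infinity>p\<in>S. (norm (k p h))\<^sup>2) \<le> (norm h)\<^sup>2"
      by (rule has_sum_le_finite_sums[OF s bound])
    moreover have "(norm h)\<^sup>2 \<le> (\<Sum>\<^sub>\<infinity>p\<in>S. (norm (k p h))\<^sup>2) + \<epsilon>" if \<epsilon>: "\<epsilon> > 0" for \<epsilon>
    proof -
      obtain E where E: "finite E" "orthonormal E"
        and close: "cmod (cinner h (\<Phi> (proj E) h) - cinner h h) < \<epsilon>"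
        using normal_ucp_near_proj[OF \<Phi> \<epsilon>, of h 1 h] by blast
      have "(norm h)\<^sup>2 - \<epsilon> \<le> Re (cinner h (\<Phi> (proj E) h))"
        using abs_Re_le_cmod[of "cinner h (\<Phi> (proj E) h) - cinner h h"] close
        by (simp add: cinner_self_Re)
      also have "\<dots> \<le> (\<Sum>\<^sub>\<infinity>p\<in>S. (norm (k p h))\<^sup>2)"
        by (rule has_sum_mono[OF fin_sq[OF E] s]) (simp add: norm_proj_le[OF E] power_mono)
      finally show ?thesis by simp
    qed
    then have "(norm h)\<^sup>2 \<le> (\<Sum>\<^sub>\<infinity>p\<in>S. (norm (k p h))\<^sup>2)"
      by (rule field_le_epsilon)
    ultimately have "(\<Sum>\<^sub>\<infinity>p\<in>S. (norm (k p h))\<^sup>2) = (norm h)\<^sup>2"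
      by (rule antisym)
    with s show ?thesis by simp
  qed
  have "(\<lambda>p. cinner (k p h) (x (k p g))) summable_on S"
  proof (rule abs_summable_summable, rule Infinite_Sum.abs_summable_on_comparison_test')
    show "(\<lambda>p. norm x * ((norm (k p h))\<^sup>2 + (norm (k p g))\<^sup>2)) summable_on S"
      by (intro summable_on_cmult_right summable_on_add has_sum_imp_summable[OF sq])
    show "cmod (cinner (k p h) (x (k p g))) \<le> norm x * ((norm (k p h))\<^sup>2 + (norm (k p g))\<^sup>2)" for p
    proof -
      have "cmod (cinner (k p h) (x (k p g))) \<le> norm (k p h) * (norm x * norm (k p g))"
        using cauchy_schwarz[of "k p h" "x (k p g)"]
          mult_left_mono[OF norm_bop_apply[of x "k p g"], of "norm (k p h)"] by simp
      also have "\<dots> = norm x * (norm (k p h) * norm (k p g))" by simp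
      also have "norm (k p h) * norm (k p g) \<le> (norm (k p h))\<^sup>2 + (norm (k p g))\<^sup>2"
      proof -
        have "0 \<le> norm (k p h) * norm (k p g)" by simp
        then show ?thesis using sum_squares_bound[of "norm (k p h)" "norm (k p g)"] by linarith
      qed
      finally show ?thesis by (simp add: mult_left_mono)
    qed
  qed
  then have s: "((\<lambda>p. cinner (k p h) (x (k p g))) has_sum
      (\<Sum>\<^sub>\<infinity>p\<in>S. cinner (k p h) (x (k p g)))) S" (is "(_ has_sum ?s) S")
    by (rule has_sum_infsum)
  have "cmod (?s - cinner h (\<Phi> x g)) \<le> 0 + e" if e: "e > 0" for e
  proof -
    \<comment> \<open>Collects the final error as \<open>\<epsilon> * c\<close>: the summand 1 comes
      from approximating \<Phi> x, the rest from truncating the sum.\<close>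
    define c where "c = 1 + norm x * (1 + (norm g)\<^sup>2)"
    have c: "c > 0" by (simp add: c_def add_pos_nonneg)
    define \<epsilon> where "\<epsilon> = e / c"
    have \<epsilon>: "\<epsilon> > 0" using e c by (simp add: \<epsilon>_def)
    \<comment> \<open>The square is needed because \<open>d\<close> will be divided by
      \<open>\<epsilon>\<close>; plain \<open>\<epsilon>\<close> serves for the approximation of
      \<Phi> x.\<close>
    define \<delta> where "\<delta> = min \<epsilon> (\<epsilon>\<^sup>2)"
    have \<delta>: "\<delta> > 0" using \<epsilon> by (simp add: \<delta>_def)
    obtain E where E: "finite E" "orthonormal E"
      and 1: "cmod (cinner h (\<Phi> (proj E) h) - cinner h h) < \<delta>"
      and 2: "cmod (cinner h (\<Phi> (proj E * x) g) - cinner h (\<Phi> x g)) < \<delta>"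
      by (rule normal_ucp_near_proj[OF \<Phi> \<delta>])
    define d where "d = (norm h)\<^sup>2 - Re (cinner h (\<Phi> (proj E) h))"
    have d: "d \<le> \<epsilon>\<^sup>2"
      using abs_Re_le_cmod[of "cinner h (\<Phi> (proj E) h) - cinner h h"] 1
      unfolding d_def \<delta>_def by (simp add: cinner_self_Re) linarith
    have "(norm (k p h))\<^sup>2 - (norm (proj E (k p h)))\<^sup>2 = (norm (k p h - proj E (k p h)))\<^sup>2" for p
      using norm_proj_pythagoras[OF E, of "k p h"] by simp
    moreover have "((\<lambda>p. (norm (k p h))\<^sup>2 - (norm (proj E (k p h)))\<^sup>2) has_sum d) S"
      using has_sum_add[OF sq[of h] has_sum_uminusI[OF fin_sq[OF E, of h]]] by (simp add: d_def)
    ultimately have rest: "((\<lambda>p. (norm (k p h - proj E (k p h)))\<^sup>2) has_sum d) S"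
      by simp
    have diff: "((\<lambda>p. cinner (k p h) (x (k p g)) - cinner (k p h) (proj E (x (k p g)))) has_sum
        ?s - cinner h (\<Phi> (proj E * x) g)) S"
      using has_sum_add[OF s has_sum_uminusI[OF fin[of h E x g]]] by simp
    have "cmod (?s - cinner h (\<Phi> (proj E * x) g)) \<le> norm x * (1 / \<epsilon> * d + \<epsilon> * (norm g)\<^sup>2)"
    proof (rule norm_infsum_le[OF diff])
      show "((\<lambda>p. norm x * (1 / \<epsilon> * (norm (k p h - proj E (k p h)))\<^sup>2 + \<epsilon> * (norm (k p g))\<^sup>2))
          has_sum norm x * (1 / \<epsilon> * d + \<epsilon> * (norm g)\<^sup>2)) S"
        by (intro has_sum_cmult_right has_sum_add rest sq)
      fix p
      define a where "a = norm (k p h - proj E (k p h))"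
      define b where "b = norm (k p g)"
      have "cinner (k p h) (x (k p g)) - cinner (k p h) (proj E (x (k p g)))
          = cinner (k p h - proj E (k p h)) (x (k p g))"
        using cinner_adj[of "proj E" "k p h" "x (k p g)"] by (simp add: cinner_diff_left)
      also have "cmod \<dots> \<le> a * (norm x * b)"
        using cauchy_schwarz[of "k p h - proj E (k p h)" "x (k p g)"]
          mult_left_mono[OF norm_bop_apply[of x "k p g"], of a] by (simp add: a_def b_def)
      also have "\<dots> = norm x * (a * b)" by simp
      \<comment> \<open>Weighted inequality of arithmetic and geometric means: the weight
        \<open>1 / \<epsilon>\<close> falls on the factor whose squares sum to \<open>d\<close>, at
        most the square of \<open>\<epsilon>\<close>.\<close>
      also have "a * b \<le> 1 / \<epsilon> * a\<^sup>2 + \<epsilon> * b\<^sup>2"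
      proof -
        have ab: "a \<ge> 0" "b \<ge> 0" by (simp_all add: a_def b_def)
        have "2 * (a * (\<epsilon> * b)) \<le> a\<^sup>2 + (\<epsilon> * b)\<^sup>2"
          using sum_squares_bound[of a "\<epsilon> * b"] by simp
        moreover have "0 \<le> a * (\<epsilon> * b)" using ab \<epsilon> by simp
        ultimately have "a * (\<epsilon> * b) \<le> a\<^sup>2 + (\<epsilon> * b)\<^sup>2" by linarith
        then show ?thesis using \<epsilon> by (simp add: field_simps power2_eq_square)
      qed
      finally show "cmod (cinner (k p h) (x (k p g)) - cinner (k p h) (proj E (x (k p g))))
          \<le> norm x * (1 / \<epsilon> * (norm (k p h - proj E (k p h)))\<^sup>2 + \<epsilon> * (norm (k p g))\<^sup>2)"
        by (simp add: a_def b_def mult_left_mono)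
    qed
    also have "\<dots> \<le> norm x * (\<epsilon> + \<epsilon> * (norm g)\<^sup>2)"
      using d \<epsilon> by (intro mult_left_mono add_right_mono) (simp_all add: field_simps power2_eq_square)
    finally have "cmod (?s - cinner h (\<Phi> x g)) \<le> norm x * (\<epsilon> + \<epsilon> * (norm g)\<^sup>2) + \<epsilon>"
      using 2 norm_triangle_ineq[of "?s - cinner h (\<Phi> (proj E * x) g)"
          "cinner h (\<Phi> (proj E * x) g) - cinner h (\<Phi> x g)"] by (simp add: \<delta>_def)
    also have "\<dots> = \<epsilon> * c" by (simp add: c_def algebra_simps)
    also have "\<dots> = e" using c by (simp add: \<epsilon>_def)
    finally show ?thesis by simp
  qed
  then have "cmod (?s - cinner h (\<Phi> x g)) \<le> 0" by (rule field_le_epsilon)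
  then have "?s = cinner h (\<Phi> x g)" by simp
  with s show ?thesis by simp
qed

theorem kraus_decomposition:
  fixes \<Phi> :: "'h :: complex_hilbert bop \<Rightarrow> 'h bop"
  assumes "normal_ucp \<Phi>"
  shows "\<exists>(S :: (nat \<times> ('h \<times> 'h \<Rightarrow> complex)) set) k. \<forall>h g x.
    ((\<lambda>p. cinner (bop_apply (k p) h) (bop_apply x (k p g))) has_sum cinner h (\<Phi> x g)) S"
proof -
  have "completely_positive \<Phi>" "\<Phi> 1 = 1" using assms by (simp_all add: normal_ucp_def)
  from kraus_on_ketbra[OF this] obtain S :: "(nat \<times> ('h \<times> 'h \<Rightarrow> complex)) set" where
    "\<exists>k. \<forall>v w h g. ((\<lambda>p. cinner (bop_apply (k p) h) (ketbra v w (k p g)))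
      has_sum cinner h (\<Phi> (ketbra v w) g)) S"
    by (rule exE)
  then obtain k where
    "\<forall>v w h g. ((\<lambda>p. cinner (bop_apply (k p) h) (ketbra v w (k p g)))
      has_sum cinner h (\<Phi> (ketbra v w) g)) S"
    by (rule exE)
  from has_sum_extend_from_ketbra[OF assms this[rule_format]]
  show ?thesis by (intro exI[of _ S] exI[of _ k] allI)
qed

text \<open>The sum for \<open>x = 1\<close> shows that the squares of \<open>norm (k i h)\<close>
  add up to the square of \<open>norm h\<close>. By Cauchy-Schwarz all partial sums for
  \<open>x\<close> are then bounded by \<open>norm x\<close>, which upgrades weak to ultraweak
  convergence.\<close>

lemma kraus_familyI:
  fixes k :: "'i \<Rightarrow> 'h :: complex_hilbert bop"
  assumes mem: "\<And>i. i \<in> I \<Longrightarrow> k i \<in> M" and one: "\<Phi> 1 = 1"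
    and sum: "\<And>h g x. ((\<lambda>i. cinner (k i h) (bop_apply x (k i g)))
      has_sum cinner h (bop_apply (\<Phi> x) g)) I"
  shows "kraus_family M I k \<Phi>"
proof -
  have sq: "((\<lambda>i. (norm (k i h))\<^sup>2) has_sum (norm h)\<^sup>2) I" for h
    using has_sum_Re[OF sum[of h 1 h]] by (simp add: one one_bop_apply cinner_self_Re)
  have eq: "cinner v ((\<Sum>i\<in>F. adj (k i) * x * k i) w) = (\<Sum>i\<in>F. cinner (k i v) (x (k i w)))" for F v w x
    by (simp add: bop_sum_apply cinner_sum_right times_bop_apply cinner_adj_right)
  have lim: "limitin ultraweak_topology (\<lambda>F. \<Sum>i\<in>F. adj (k i) * x * k i) (\<Phi> x)
      (finite_subsets_at_top I)" for x
  proof -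
    \<comment> \<open>Intersecting with \<open>I\<close> makes the uniform bound hold for every set
      \<open>F\<close>; along the filter nothing changes.\<close>
    define T where "T F = (\<Sum>i\<in>F \<inter> I. adj (k i) * x * k i)" for F
    have "limitin ultraweak_topology T (\<Phi> x) (finite_subsets_at_top I)"
    proof (rule limitin_ultraweak_bounded)
      show "cmod (cinner v (T F w)) \<le> norm x * (norm v * norm w)" for F v w
      proof (cases "finite (F \<inter> I)")
        case True
        have L2: "L2_set (\<lambda>i. norm (k i h)) (F \<inter> I) \<le> norm h" for h
          unfolding L2_set_def
          by (rule real_le_lsqrt)
             (use True finite_sum_le_has_sum[OF sq[of h], of "F \<inter> I"] in \<open>auto intro: sum_nonneg\<close>)
        have "cmod (cinner v (T F w)) \<le> (\<Sum>i\<in>F \<inter> I. norm x * (norm (k i v) * norm (k i w)))"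
          unfolding T_def eq
        proof (rule sum_norm_le)
          show "cmod (cinner (k i v) (x (k i w))) \<le> norm x * (norm (k i v) * norm (k i w))" for i
            using cauchy_schwarz[of "k i v" "x (k i w)"]
              mult_left_mono[OF norm_bop_apply[of x "k i w"], of "norm (k i v)"]
            by (simp add: mult_ac)
        qed
        also have "\<dots> \<le> norm x * (L2_set (\<lambda>i. norm (k i v)) (F \<inter> I) * L2_set (\<lambda>i. norm (k i w)) (F \<inter> I))"
          using L2_set_mult_ineq[of "\<lambda>i. norm (k i v)" "\<lambda>i. norm (k i w)" "F \<inter> I"]
          by (simp add: mult_left_mono flip: sum_distrib_left)
        also have "\<dots> \<le> norm x * (norm v * norm w)"
          by (intro mult_left_mono mult_mono L2) simp_all
        finally show ?thesis .
      next
        case False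
        then show ?thesis by (simp add: T_def)
      qed
      show "((\<lambda>F. cinner v (T F w)) \<longlongrightarrow> cinner v (\<Phi> x w)) (finite_subsets_at_top I)" for v w
      proof (rule Lim_transform_eventually)
        show "(sum (\<lambda>i. cinner (k i v) (x (k i w))) \<longlongrightarrow> cinner v (\<Phi> x w)) (finite_subsets_at_top I)"
          using sum[of v x w] by (simp add: has_sum_def)
        show "\<forall>\<^sub>F F in finite_subsets_at_top I.
            (\<Sum>i\<in>F. cinner (k i v) (x (k i w))) = cinner v (T F w)"
          by (rule eventually_finite_subsets_at_top_weakI) (simp add: T_def eq Int_absorb2)
      qed
    qed simp
    moreover have "\<forall>\<^sub>F F in finite_subsets_at_top I. T F = (\<Sum>i\<in>F. adj (k i) * x * k i)"
      by (rule eventually_finite_subsets_at_top_weakI) (simp add: T_def Int_absorb2)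
    ultimately show ?thesis by (rule limitin_transform_eventually[rotated])
  qed
  show ?thesis
    unfolding kraus_family_def using mem lim lim[of 1] by (simp add: one)
qed


section \<open>Von Neumann algebras and inner channels\<close>

lemma commutant_one: "1 \<in> commutant S"
  by (simp add: commutant_def)

lemma commutant_diff: "x \<in> commutant S \<Longrightarrow> y \<in> commutant S \<Longrightarrow> x - y \<in> commutant S"
  by (simp add: commutant_def algebra_simps)

lemma commutant_add: "x \<in> commutant S \<Longrightarrow> y \<in> commutant S \<Longrightarrow> x + y \<in> commutant S"
  by (simp add: commutant_def algebra_simps)

lemma commutant_scaleC: "x \<in> commutant S \<Longrightarrow> c *\<^sub>C x \<in> commutant S"
  by (simp add: commutant_def times_scaleC_left times_scaleC_right)

lemma commutant_times:
  assumes "x \<in> commutant S" "y \<in> commutant S"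
  shows "x * y \<in> commutant S"
  using assms unfolding commutant_def by (simp add: mult.assoc) (simp flip: mult.assoc)

lemma commutant_adj:
  assumes "adj ` S \<subseteq> S" "x \<in> commutant S"
  shows "adj x \<in> commutant S"
  unfolding commutant_def
proof (intro CollectI ballI)
  fix y assume "y \<in> S"
  then have "adj y \<in> S" using assms(1) by blast
  then have "x * adj y = adj y * x" using assms(2) by (simp add: commutant_def)
  from arg_cong[OF this, of adj] show "adj x * y = y * adj x" by (simp add: adj_times)
qed

lemma commutant_commutant_commutant: "commutant (commutant (commutant S)) = commutant S"
proof -
  have sub: "X \<subseteq> commutant (commutant X)" for X :: "'a bop set"
    by (auto simp: commutant_def)
  have "commutant (commutant (commutant S)) \<subseteq> commutant S"
    using sub[of S] by (auto simp: commutant_def)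
  then show ?thesis using sub by (rule antisym)
qed

lemma closed_commutant: "closed (commutant S)" for S :: "'h :: complex_hilbert bop set"
proof -
  have "commutant S = (\<Inter>x\<in>S. {T. T * x = x * T})" by (auto simp: commutant_def)
  also have "closed \<dots>"
    by (intro closed_INT ballI closed_Collect_eq continuous_intros)
  finally show ?thesis .
qed

lemma von_neumann_algebra_commutant:
  "adj ` S \<subseteq> S \<Longrightarrow> von_neumann_algebra (commutant S)"
  by (auto simp: von_neumann_algebra_def commutant_commutant_commutant intro: commutant_adj)

lemma von_neumann_algebraD:
  assumes "von_neumann_algebra M"
  shows "x \<in> M \<Longrightarrow> adj x \<in> M" "M = commutant (commutant M)"
  using assms by (auto simp: von_neumann_algebra_def)

lemma vn_generated_adj: "x \<in> vn_generated S \<Longrightarrow> adj x \<in> vn_generated S"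
  by (auto simp: vn_generated_def dest: von_neumann_algebraD(1))

lemma vn_generated_times:
  assumes "x \<in> vn_generated S" "y \<in> vn_generated S"
  shows "x * y \<in> vn_generated S"
  unfolding vn_generated_def
proof (intro InterI, elim CollectE conjE)
  fix M assume "von_neumann_algebra M" "S \<subseteq> M"
  then show "x * y \<in> M"
    using assms von_neumann_algebraD(2)[of M] commutant_times[of x "commutant M" y]
    by (auto simp: vn_generated_def)
qed

lemma vn_generated_subset_commutant:
  assumes "adj ` M \<subseteq> M" "S \<subseteq> commutant M"
  shows "vn_generated S \<subseteq> commutant M"
  using von_neumann_algebra_commutant[OF assms(1)] assms(2) by (auto simp: vn_generated_def)

text \<open>An element \<open>y\<close> commuting with all \<open>k i\<close> can be pulled out of
  the partial sums, leaving the sums of \<open>adj (k i) * k i\<close>, which tend to 1.\<close>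

lemma inner_channel_fixes_commutant:
  fixes M :: "'h :: complex_hilbert bop set"
  assumes "inner_channel M \<Phi>" "y \<in> commutant M"
  shows "\<Phi> y = y"
proof -
  obtain I :: "('h \<times> nat) set" and k where fam: "kraus_family M I k \<Phi>"
    using assms(1) by (auto simp: inner_channel_def)
  let ?F = "finite_subsets_at_top I"
  have lim: "((\<lambda>F. cinner v (T F w)) \<longlongrightarrow> cinner v (bop_apply L w)) ?F"
    if "limitin ultraweak_topology T L ?F" for T :: "_ \<Rightarrow> 'h bop" and L v w
    using continuous_map_limit[OF continuous_map_ultraweak_cinner that, of v w]
    by (simp add: o_def)
  show ?thesis
  proof (rule bop_eqI_cinner)
    fix v w
    have 1: "((\<lambda>F. cinner v ((\<Sum>i\<in>F. adj (k i) * y * k i) w)) \<longlongrightarrow> cinner v (\<Phi> y w)) ?F"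
      by (rule lim) (use fam in \<open>simp add: kraus_family_def\<close>)
    have 2: "((\<lambda>F. cinner v ((\<Sum>i\<in>F. adj (k i) * k i) (y w))) \<longlongrightarrow> cinner v ((1 :: 'h bop) (y w))) ?F"
      by (rule lim) (use fam in \<open>simp add: kraus_family_def\<close>)
    have 3: "\<forall>\<^sub>F F in ?F. cinner v ((\<Sum>i\<in>F. adj (k i) * k i) (y w))
        = cinner v ((\<Sum>i\<in>F. adj (k i) * y * k i) w)"
    proof (rule eventually_finite_subsets_at_top_weakI)
      fix F assume "finite F" "F \<subseteq> I"
      then have "y * k i = k i * y" if "i \<in> F" for i
        using that fam assms(2) by (auto simp: kraus_family_def commutant_def)
      then have "(\<Sum>i\<in>F. adj (k i) * y * k i) = (\<Sum>i\<in>F. adj (k i) * k i) * y"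
        unfolding sum_distrib_right by (intro sum.cong) (simp_all add: mult.assoc)
      then show "cinner v ((\<Sum>i\<in>F. adj (k i) * k i) (y w))
          = cinner v ((\<Sum>i\<in>F. adj (k i) * y * k i) w)"
        by (simp add: times_bop_apply)
    qed
    have "cinner v (\<Phi> y w) = cinner v ((1 :: 'h bop) (y w))"
      by (rule tendsto_unique[OF _ 1 Lim_transform_eventually[OF 2 3]]) simp
    then show "cinner v (\<Phi> y w) = cinner v (y w)" by (simp add: one_bop_apply)
  qed
qed

text \<open>If \<open>\<Phi>\<close> fixes \<open>y\<close>, \<open>adj y\<close> and \<open>adj y * y\<close>, then summing
  \<open>adj (k y - y k) * (k y - y k)\<close> over the Kraus operators \<open>k\<close> gives 0.\<close>

lemma inner_channel_commutant:
  fixes R :: "'h :: complex_hilbert bop set"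
  assumes \<Phi>: "normal_ucp \<Phi>" and fixed: "\<And>y. y \<in> R \<Longrightarrow> \<Phi> y = y"
    and adj: "\<And>y. y \<in> R \<Longrightarrow> adj y \<in> R" and times: "\<And>x y. x \<in> R \<Longrightarrow> y \<in> R \<Longrightarrow> x * y \<in> R"
  shows "inner_channel (commutant R) \<Phi>"
proof -
  have one: "\<Phi> 1 = 1" using \<Phi> by (simp add: normal_ucp_def)
  from kraus_decomposition[OF \<Phi>] obtain S :: "(nat \<times> ('h \<times> 'h \<Rightarrow> complex)) set" where
    "\<exists>k. \<forall>h g x. ((\<lambda>p. cinner (bop_apply (k p) h) (bop_apply x (k p g))) has_sum cinner h (\<Phi> x g)) S"
    by (rule exE)
  then obtain k where k:
    "\<forall>h g x. ((\<lambda>p. cinner (bop_apply (k p) h) (bop_apply x (k p g))) has_sum cinner h (\<Phi> x g)) S"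
    by (rule exE)
  note sum = k[rule_format]
  have "k p * y = y * k p" if p: "p \<in> S" and y: "y \<in> R" for p y
  proof (rule bop_eqI)
    fix h
    have total: "((\<lambda>p. cinner (k p (y h)) ((1 :: 'h bop) (k p (y h))) - cinner (k p (y h)) (y (k p h))
        - cinner (k p h) (adj y (k p (y h))) + cinner (k p h) ((adj y * y) (k p h)))
        has_sum cinner (y h) (\<Phi> 1 (y h)) - cinner (y h) (\<Phi> y h)
        - cinner h (\<Phi> (adj y) (y h)) + cinner h (\<Phi> (adj y * y) h)) S"
      using has_sum_add[OF has_sum_add[OF has_sum_add[OF sum has_sum_uminusI[OF sum]]
          has_sum_uminusI[OF sum]] sum] by simp
    \<comment> \<open>Each of the four terms is plus or minus the square of
      \<open>norm (y h)\<close>, since \<Phi> fixes 1, \<open>y\<close>, \<open>adj y\<close> and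
      \<open>adj y * y\<close>.\<close>
    have 0: "cinner (y h) (\<Phi> 1 (y h)) - cinner (y h) (\<Phi> y h)
        - cinner h (\<Phi> (adj y) (y h)) + cinner h (\<Phi> (adj y * y) h) = 0"
      by (simp add: one fixed y adj times one_bop_apply times_bop_apply cinner_adj_right)
    have sq: "cinner (k p (y h)) ((1 :: 'h bop) (k p (y h))) - cinner (k p (y h)) (y (k p h))
        - cinner (k p h) (adj y (k p (y h))) + cinner (k p h) ((adj y * y) (k p h))
        = of_real ((norm (k p (y h) - y (k p h)))\<^sup>2)" for p
      unfolding cinner_self[symmetric]
      by (simp add: one_bop_apply times_bop_apply cinner_adj_right cinner_diff_left
          cinner_diff_right)
    have "((\<lambda>p. complex_of_real ((norm (k p (y h) - y (k p h)))\<^sup>2)) has_sum of_real 0) S"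
      using total unfolding 0 sq by simp
    then have "((\<lambda>p. (norm (k p (y h) - y (k p h)))\<^sup>2) has_sum 0) S"
      unfolding has_sum_of_real_iff .
    then have "(norm (k p (y h) - y (k p h)))\<^sup>2 = 0"
      by (rule nonneg_has_sum_le_0D) (simp_all add: p)
    then show "(k p * y) h = (y * k p) h" by (simp add: times_bop_apply)
  qed
  then have "kraus_family (commutant R) S k \<Phi>"
    by (intro kraus_familyI one sum) (simp add: commutant_def)
  \<comment> \<open>The Kraus index set lives in a type of functions; \<open>inner_channelI\<close>
    moves it to the index type fixed in \<open>inner_channel\<close>.\<close>
  with \<Phi> show ?thesis by (rule inner_channelI)
qed


section \<open>Unitary channels\<close>

lemma norm_isometry_apply:
  assumes "adj u * u = 1"
  shows "norm (bop_apply u x) = norm (x :: 'h :: complex_hilbert)"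
proof -
  have "cinner (u x) (u x) = cinner x x"
    by (metis assms cinner_adj_right one_bop_apply times_bop_apply)
  then have "(norm (u x))\<^sup>2 = (norm x)\<^sup>2"
    by (metis cinner_self_Re)
  then show ?thesis by simp
qed

lemma normal_ucp_Ad:
  assumes u: "adj u * u = (1 :: 'h :: complex_hilbert bop)"
  shows "normal_ucp (Ad u)"
  unfolding normal_ucp_def completely_positive_def
proof (intro conjI allI impI)
  show "Ad u (x + y) = Ad u x + Ad u y" for x y by (simp add: Ad_def algebra_simps)
  show "Ad u (c *\<^sub>C x) = c *\<^sub>C Ad u x" for c x
    by (simp add: Ad_def times_scaleC_left times_scaleC_right)
  show "Ad u 1 = 1" by (simp add: Ad_def u)
  have "Ad u = (\<lambda>x. adj u * x * u)" by (simp add: Ad_def fun_eq_iff)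
  then show "continuous_map ultraweak_topology ultraweak_topology (Ad u)"
    using continuous_map_ultraweak_times[of "adj u" u] by simp
  fix n :: nat and X :: "nat \<Rightarrow> nat \<Rightarrow> 'h bop" assume X: "matrix_positive n X"
  show "matrix_positive n (\<lambda>i j. Ad u (X i j))"
    unfolding matrix_positive_def
  proof
    fix \<xi> :: "nat \<Rightarrow> 'h"
    have "(\<Sum>i<n. cinner (\<xi> i) (\<Sum>j<n. Ad u (X i j) (\<xi> j)))
        = (\<Sum>i<n. cinner (u (\<xi> i)) (\<Sum>j<n. X i j (u (\<xi> j))))"
      by (simp add: Ad_def times_bop_apply cinner_adj_right cinner_sum_right)
    also have "\<dots> \<in> \<real>\<^sub>\<ge>\<^sub>0"
      using X[unfolded matrix_positive_def, rule_format, of "\<lambda>i. u (\<xi> i)"] .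
    finally show "(\<Sum>i<n. cinner (\<xi> i) (\<Sum>j<n. Ad u (X i j) (\<xi> j))) \<in> \<real>\<^sub>\<ge>\<^sub>0" .
  qed
qed

lemma Ad_fixes:
  assumes "adj u * u = 1" "u \<in> commutant R" "y \<in> R"
  shows "Ad u y = y"
proof -
  have "u * y = y * u" using assms by (simp add: commutant_def)
  then have "Ad u y = adj u * u * y" by (simp add: Ad_def mult.assoc)
  then show ?thesis using assms by simp
qed

lemma inner_channel_AdD:
  assumes M: "von_neumann_algebra M" and u: "u * adj u = 1" and inner: "inner_channel M (Ad u)"
  shows "u \<in> M"
proof -
  have "u * y = y * u" if "y \<in> commutant M" for y
  proof -
    have "u * (adj u * y * u) = u * y"
      using inner_channel_fixes_commutant[OF inner that] by (simp add: Ad_def)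
    then show ?thesis using u by (metis mult.assoc mult_1)
  qed
  then have "u \<in> commutant (commutant M)" by (simp add: commutant_def)
  then show ?thesis using von_neumann_algebraD(2)[OF M] by simp
qed

section \<open>Completely bounded distance of a unitary channel from the identity\<close>

lemma matrix_norm_le_1D:
  fixes X :: "nat \<Rightarrow> nat \<Rightarrow> 'h :: complex_hilbert bop"
  assumes "matrix_norm n X \<le> 1"
  shows "L2_set (\<lambda>i. norm (\<Sum>j<n. X i j (\<xi> j))) {..<n} \<le> L2_set (\<lambda>i. norm (\<xi> i)) {..<n}"
proof (cases "L2_set (\<lambda>i. norm (\<xi> i)) {..<n} = 0")
  case True
  then have "\<xi> j = 0" if "j < n" for j using that by (simp add: L2_set_eq_0_iff)
  then have "L2_set (\<lambda>i. norm (\<Sum>j<n. X i j (\<xi> j))) {..<n} = 0"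
    by (intro L2_set_0') simp
  then show ?thesis by simp
next
  case False
  define s where "s = L2_set (\<lambda>i. norm (\<xi> i)) {..<n}"
  have s: "s > 0" using False L2_set_nonneg[of _ "{..<n}"] by (simp add: s_def less_le)
  define \<zeta> where "\<zeta> i = (1 / s) *\<^sub>R \<xi> i" for i
  have scale: "L2_set (\<lambda>i. norm ((1 / s) *\<^sub>R f i)) {..<n} = 1 / s * L2_set (\<lambda>i. norm (f i)) {..<n}"
    for f :: "nat \<Rightarrow> 'h"
    using s by (subst L2_set_right_distrib) simp_all
  have "L2_set (\<lambda>i. norm (\<zeta> i)) {..<n} = 1"
    unfolding \<zeta>_def scale s_def[symmetric] using s by simp
  then have "(\<Sum>i<n. (norm (\<zeta> i))\<^sup>2) \<le> 1"
    using s by (simp add: L2_set_def)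
  then have "ennreal (sqrt (\<Sum>i<n. (norm (\<Sum>j<n. X i j (\<zeta> j)))\<^sup>2)) \<le> matrix_norm n X"
    unfolding matrix_norm_def by (intro SUP_upper) simp
  also note assms
  finally have "L2_set (\<lambda>i. norm (\<Sum>j<n. X i j (\<zeta> j))) {..<n} \<le> 1"
    by (simp add: L2_set_def)
  also have "L2_set (\<lambda>i. norm (\<Sum>j<n. X i j (\<zeta> j))) {..<n}
      = 1 / s * L2_set (\<lambda>i. norm (\<Sum>j<n. X i j (\<xi> j))) {..<n}"
    unfolding \<zeta>_def bop_scaleR_right scaleR_right.sum[symmetric] by (rule scale)
  finally show ?thesis using s by (simp add: s_def[symmetric] field_simps)
qed

lemma L2_set_norm_bop_le:
  fixes T :: "'h :: complex_hilbert bop"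
  shows "L2_set (\<lambda>i. norm (T (\<xi> i))) A \<le> norm T * L2_set (\<lambda>i. norm (\<xi> i)) A"
  unfolding L2_set_right_distrib[OF norm_ge_zero]
  by (intro L2_set_mono) (simp_all add: norm_bop_apply)

text \<open>Both terms of \<open>adj u * x * u - x = adj u * x * (u - 1) + adj (u - 1) * x\<close> are at most
  \<open>norm (u - 1)\<close> when \<open>x\<close> is a contraction.\<close>

lemma cb_norm_Ad_diff_le:
  fixes u :: "'h :: complex_hilbert bop"
  assumes u: "adj u * u = 1"
  shows "cb_norm (\<lambda>x. Ad u x - x) \<le> ennreal (2 * norm (u - 1))"
  unfolding cb_norm_def
proof (intro SUP_least, elim CollectE)
  fix n and X :: "nat \<Rightarrow> nat \<Rightarrow> 'h bop" assume X: "matrix_norm n X \<le> 1"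
  have u1: "norm (adj u) \<le> 1"
    using norm_adj_le[of u] norm_bop_leI[of 1 u] norm_isometry_apply[OF u] by force
  have adj_diff: "adj (u - 1) = adj u - 1"
    using linear_diff[OF bounded_linear.linear[OF bounded_linear_adj], of u 1] by simp
  show "matrix_norm n (\<lambda>i j. Ad u (X i j) - X i j) \<le> ennreal (2 * norm (u - 1))"
    unfolding matrix_norm_def
  proof (intro SUP_least ennreal_leI, elim CollectE)
    fix \<xi> :: "nat \<Rightarrow> 'h" assume "(\<Sum>i<n. (norm (\<xi> i))\<^sup>2) \<le> 1"
    then have \<xi>: "L2_set (\<lambda>i. norm (\<xi> i)) {..<n} \<le> 1" by (simp add: L2_set_def)
    define Y where "Y \<zeta> i = (\<Sum>j<n. X i j (\<zeta> j))" for \<zeta> i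
    define \<eta> where "\<eta> j = (u - 1) (\<xi> j)" for j
    have Y: "L2_set (\<lambda>i. norm (Y \<zeta> i)) {..<n} \<le> L2_set (\<lambda>i. norm (\<zeta> i)) {..<n}" for \<zeta>
      unfolding Y_def by (rule matrix_norm_le_1D[OF X])
    have "L2_set (\<lambda>i. norm (adj u (Y \<eta> i))) {..<n} \<le> norm (adj u) * L2_set (\<lambda>i. norm (Y \<eta> i)) {..<n}"
      by (rule L2_set_norm_bop_le)
    also have "\<dots> \<le> L2_set (\<lambda>i. norm (Y \<eta> i)) {..<n}"
      using u1 L2_set_nonneg[of "\<lambda>i. norm (Y \<eta> i)" "{..<n}"] by (simp add: mult_left_le_one_le)
    also have "\<dots> \<le> L2_set (\<lambda>i. norm (\<eta> i)) {..<n}" by (rule Y)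
    also have "\<dots> \<le> norm (u - 1) * L2_set (\<lambda>i. norm (\<xi> i)) {..<n}"
      unfolding \<eta>_def by (rule L2_set_norm_bop_le)
    also have "\<dots> \<le> norm (u - 1)" using \<xi> by (simp add: mult_left_le)
    finally have 1: "L2_set (\<lambda>i. norm (adj u (Y \<eta> i))) {..<n} \<le> norm (u - 1)" .
    have "L2_set (\<lambda>i. norm (adj (u - 1) (Y \<xi> i))) {..<n}
        \<le> norm (adj (u - 1)) * L2_set (\<lambda>i. norm (Y \<xi> i)) {..<n}"
      by (rule L2_set_norm_bop_le)
    also have "\<dots> \<le> norm (u - 1) * 1"
      by (intro mult_mono norm_adj_le order_trans[OF Y \<xi>]) simp_all
    finally have 2: "L2_set (\<lambda>i. norm (adj (u - 1) (Y \<xi> i))) {..<n} \<le> norm (u - 1)" by simp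
    have "(\<Sum>j<n. (Ad u (X i j) - X i j) (\<xi> j)) = adj u (Y \<eta> i) + adj (u - 1) (Y \<xi> i)" for i
      by (simp add: Y_def \<eta>_def Ad_def adj_diff bop_diff_apply one_bop_apply times_bop_apply
          bop_sum_right bop_diff_right sum_subtractf)
    then have "sqrt (\<Sum>i<n. (norm (\<Sum>j<n. (Ad u (X i j) - X i j) (\<xi> j)))\<^sup>2)
        = L2_set (\<lambda>i. norm (adj u (Y \<eta> i) + adj (u - 1) (Y \<xi> i))) {..<n}"
      by (simp add: L2_set_def)
    also have "\<dots> \<le> L2_set (\<lambda>i. norm (adj u (Y \<eta> i)) + norm (adj (u - 1) (Y \<xi> i))) {..<n}"
      by (intro L2_set_mono norm_triangle_ineq) simp
    also have "\<dots> \<le> L2_set (\<lambda>i. norm (adj u (Y \<eta> i))) {..<n} + L2_set (\<lambda>i. norm (adj (u - 1) (Y \<xi> i))) {..<n}"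
      by (rule L2_set_triangle_ineq)
    also have "\<dots> \<le> 2 * norm (u - 1)" using 1 2 by simp
    finally show "sqrt (\<Sum>i<n. (norm (\<Sum>j<n. (Ad u (X i j) - X i j) (\<xi> j)))\<^sup>2) \<le> 2 * norm (u - 1)" .
  qed
qed


section \<open>The exponential\<close>

text \<open>The scalar is kept apart from the power of \<open>a\<close>, so that identities between
  exponentials of multiples of one operator reduce to identities of scalar coefficients.\<close>

definition exp_term :: "'h :: complex_hilbert bop \<Rightarrow> complex \<Rightarrow> nat \<Rightarrow> 'h bop"
  where "exp_term a c n = (c ^ n /\<^sub>R fact n) *\<^sub>C a ^ n"

lemma scaleC_bop_power: "(c *\<^sub>C a) ^ n = c ^ n *\<^sub>C a ^ n" for a :: "'h :: complex_hilbert bop"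
  by (induction n) (simp_all add: times_scaleC_left times_scaleC_right scaleC_scaleC mult.commute)

lemma bop_exp_scaleC: "bop_exp (c *\<^sub>C a) = (\<Sum>n. exp_term a c n)"
proof -
  have "(c *\<^sub>C a) ^ n /\<^sub>R fact n = exp_term a c n" for n
    by (simp add: exp_term_def scaleC_bop_power scaleR_scaleC scaleC_scaleC scaleR_conv_of_real
        mult.commute)
  then show ?thesis by (simp add: bop_exp_def)
qed

lemma norm_exp_term_le:
  fixes a :: "'h :: complex_hilbert bop"
  shows "norm (exp_term a c n) \<le> (cmod c * norm a) ^ n /\<^sub>R fact n"
proof -
  have "norm (a ^ n) \<le> norm a ^ n"
  proof (induction n)
    case (Suc n)
    then show ?case
      using norm_mult_ineq[of a "a ^ n"] mult_left_mono[of "norm (a ^ n)" "norm a ^ n" "norm a"]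
      by simp
  qed (simp add: norm_one_bop_le)
  then have "cmod (c ^ n /\<^sub>R fact n) * norm (a ^ n) \<le> cmod (c ^ n /\<^sub>R fact n) * norm a ^ n"
    by (rule mult_left_mono) simp
  then show ?thesis
    using norm_scaleC_bop_le[of "c ^ n /\<^sub>R fact n" "a ^ n"]
    by (simp add: exp_term_def norm_power power_mult_distrib field_simps)
qed

lemma summable_norm_exp_term: "summable (\<lambda>n. norm (exp_term a c n))"
proof (rule summable_comparison_test'[OF summable_exp_generic[of "cmod c * norm a"]])
  show "norm (norm (exp_term a c n)) \<le> (cmod c * norm a) ^ n /\<^sub>R fact n" for n
    unfolding real_norm_def abs_norm_cancel by (rule norm_exp_term_le)
qed

lemma summable_exp_term: "summable (exp_term a c)"
  using summable_norm_exp_term by (rule summable_norm_cancel)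

text \<open>In the Cauchy product the powers of \<open>a\<close> combine to \<open>a ^ n\<close>,
  and the scalar coefficients obey the addition formula of the complex exponential series.\<close>

lemma bop_exp_add:
  fixes a :: "'h :: complex_hilbert bop"
  shows "bop_exp (c *\<^sub>C a) * bop_exp (d *\<^sub>C a) = bop_exp ((c + d) *\<^sub>C a)"
proof -
  have "(\<Sum>i\<le>n. exp_term a c i * exp_term a d (n - i)) = exp_term a (c + d) n" for n
  proof -
    have "(\<Sum>i\<le>n. exp_term a c i * exp_term a d (n - i))
        = (\<Sum>i\<le>n. ((c ^ i /\<^sub>R fact i) * (d ^ (n - i) /\<^sub>R fact (n - i))) *\<^sub>C a ^ n)"
    proof (rule sum.cong)
      fix i assume "i \<in> {..n}"
      then have "a ^ i * a ^ (n - i) = a ^ n" by (simp flip: power_add)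
      then show "exp_term a c i * exp_term a d (n - i)
          = ((c ^ i /\<^sub>R fact i) * (d ^ (n - i) /\<^sub>R fact (n - i))) *\<^sub>C a ^ n"
        by (simp only: exp_term_def times_scaleC_left times_scaleC_right scaleC_scaleC mult.commute)
    qed simp
    also have "\<dots> = ((c + d) ^ n /\<^sub>R fact n) *\<^sub>C a ^ n"
      by (simp only: scaleC_sum_left[symmetric] exp_series_add_commuting[OF mult.commute])
    finally show ?thesis by (simp only: exp_term_def)
  qed
  then show ?thesis
    using Cauchy_product[OF summable_norm_exp_term[of a c] summable_norm_exp_term[of a d]]
    by (simp add: bop_exp_scaleC)
qed

lemma bop_exp_zero: "bop_exp (0 *\<^sub>C a) = 1"
proof -
  have "(\<Sum>n. exp_term a 0 n) = (\<Sum>n\<in>{0}. exp_term a 0 n)"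
    by (rule suminf_finite) (auto simp: exp_term_def zero_power)
  also have "\<dots> = 1" by (simp add: exp_term_def)
  finally show ?thesis unfolding bop_exp_scaleC .
qed

lemma adj_bop_exp:
  fixes a :: "'h :: complex_hilbert bop"
  assumes "adj a = a"
  shows "adj (bop_exp (c *\<^sub>C a)) = bop_exp (cnj c *\<^sub>C a)"
proof -
  have "adj (a ^ n) = a ^ n" for n
    by (induction n) (simp_all add: adj_times assms power_commutes)
  then have "adj (exp_term a c n) = exp_term a (cnj c) n" for n
    by (simp add: exp_term_def adj_scaleC)
  then show ?thesis
    unfolding bop_exp_scaleC
    by (simp add: bounded_linear.suminf[OF bounded_linear_adj summable_exp_term])
qed

text \<open>The conjugate of \<open>\<i> * t\<close> is its negative, so \<open>adj u\<close> is the
  exponential at the opposite parameter and both products collapse by the addition theorem.\<close>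

lemma bop_exp_unitary:
  fixes a :: "'h :: complex_hilbert bop" and t :: real
  assumes "adj a = a"
  defines "u \<equiv> bop_exp ((\<i> * of_real t) *\<^sub>C a)"
  shows "adj u * u = 1" "u * adj u = 1"
  by (simp_all add: u_def adj_bop_exp[OF assms(1)] bop_exp_add bop_exp_zero del: scaleC_zero_left)

lemma bop_exp_commutant:
  assumes "a \<in> commutant S"
  shows "bop_exp (c *\<^sub>C a) \<in> commutant S"
  unfolding commutant_def
proof (intro CollectI ballI)
  fix x assume "x \<in> S"
  then have ax: "a * x = x * a" using assms by (simp add: commutant_def)
  have "a ^ n * x = x * a ^ n" for n
  proof (induction n)
    case (Suc n)
    have "a ^ Suc n * x = a * (a ^ n * x)" by (simp add: mult.assoc)
    also have "\<dots> = x * a ^ Suc n" by (simp add: Suc ax flip: mult.assoc)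
    finally show ?case .
  qed simp
  then have "exp_term a c n * x = x * exp_term a c n" for n
    by (simp add: exp_term_def times_scaleC_left times_scaleC_right)
  then show "bop_exp (c *\<^sub>C a) * x = x * bop_exp (c *\<^sub>C a)"
    unfolding bop_exp_scaleC
    by (simp add: suminf_mult2[OF summable_exp_term] flip: suminf_mult[OF summable_exp_term])
qed

text \<open>Removing the terms of order 0 and 1 leaves a series dominated term by term by the same
  tail of the real exponential.\<close>

lemma norm_bop_exp_diff_le:
  fixes a :: "'h :: complex_hilbert bop"
  shows "norm (bop_exp (c *\<^sub>C a) - 1 - c *\<^sub>C a) \<le> exp (cmod c * norm a) - 1 - cmod c * norm a"
proof -
  define r where "r = cmod c * norm a"
  have sumr: "summable (\<lambda>n. r ^ n /\<^sub>R fact n)" by (rule summable_exp_generic)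
  have "bop_exp (c *\<^sub>C a) = (\<Sum>n. exp_term a c (n + 2)) + (1 + c *\<^sub>C a)"
    unfolding bop_exp_scaleC suminf_split_initial_segment[OF summable_exp_term, of _ _ 2]
    by (simp add: numeral_2_eq_2 exp_term_def)
  then have "norm (bop_exp (c *\<^sub>C a) - 1 - c *\<^sub>C a) = norm (\<Sum>n. exp_term a c (n + 2))"
    by (simp add: algebra_simps)
  also have "\<dots> \<le> (\<Sum>n. r ^ (n + 2) /\<^sub>R fact (n + 2))"
    unfolding r_def
  proof (rule norm_suminf_le[OF norm_exp_term_le])
    show "summable (\<lambda>n. (cmod c * norm a) ^ (n + 2) /\<^sub>R fact (n + 2))"
      using sumr unfolding r_def by (subst summable_iff_shift)
  qed
  also have "\<dots> = exp r - 1 - r"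
    using suminf_split_initial_segment[OF sumr, of 2]
    by (simp add: numeral_2_eq_2 exp_def)
  finally show ?thesis by (simp add: r_def)
qed

text \<open>The error is at most a real difference quotient minus its limit: after division by
  \<bar>t\<bar> the tail bound compares the slope of \<open>exp (s * m)\<close> at
  \<open>s = \<bar>t\<bar>\<close> with its derivative \<open>m\<close> at 0.\<close>

lemma tendsto_bop_exp_difference_quotient:
  fixes a :: "'h :: complex_hilbert bop"
  shows "((\<lambda>t :: real. (1 / (\<i> * of_real t)) *\<^sub>C (bop_exp ((\<i> * of_real t) *\<^sub>C a) - 1)) \<longlongrightarrow> a) (at 0)"
proof -
  define m where "m = norm a"
  have "((\<lambda>s. exp (s * m)) has_real_derivative m) (at 0)"
    by (auto intro!: derivative_eq_intros)
  then have "((\<lambda>s. (exp (s * m) - 1) / s) \<longlongrightarrow> m) (at 0)"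
    by (simp add: DERIV_def)
  from tendsto_diff[OF this tendsto_const[of m]]
  have lim: "((\<lambda>s. (exp (s * m) - 1) / s - m) \<longlongrightarrow> 0) (at 0)" by simp
  \<comment> \<open>The error bound depends on \<bar>t\<bar>, so the limit in \<open>s\<close> is
    composed with the absolute value, which avoids 0 away from 0.\<close>
  have "filterlim (\<lambda>t :: real. \<bar>t\<bar>) (at 0) (at 0)"
    unfolding filterlim_at by (auto intro!: tendsto_eq_intros simp: eventually_at intro: exI[of _ 1])
  from filterlim_compose[OF lim this]
  have "((\<lambda>t. (exp (\<bar>t\<bar> * m) - 1) / \<bar>t\<bar> - m) \<longlongrightarrow> 0) (at 0)" .
  moreover have "\<forall>\<^sub>F t in at 0. norm ((1 / (\<i> * of_real t)) *\<^sub>C (bop_exp ((\<i> * of_real t) *\<^sub>C a) - 1) - a)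
      \<le> (exp (\<bar>t\<bar> * m) - 1) / \<bar>t\<bar> - m"
  proof (rule eventually_mono[OF eventually_neq_at_within])
    fix t :: real assume t: "t \<noteq> 0"
    let ?u = "bop_exp ((\<i> * of_real t) *\<^sub>C a)"
    have "(1 / (\<i> * of_real t)) *\<^sub>C (?u - 1) - a = (1 / (\<i> * of_real t)) *\<^sub>C (?u - 1 - (\<i> * of_real t) *\<^sub>C a)"
      using t by (simp add: scaleC_diff_right scaleC_scaleC)
    also have "norm \<dots> \<le> 1 / \<bar>t\<bar> * norm (?u - 1 - (\<i> * of_real t) *\<^sub>C a)"
      using norm_scaleC_bop_le[of "1 / (\<i> * of_real t)" "?u - 1 - (\<i> * of_real t) *\<^sub>C a"]
      by (simp add: norm_divide norm_mult)
    also have "\<dots> \<le> 1 / \<bar>t\<bar> * (exp (\<bar>t\<bar> * m) - 1 - \<bar>t\<bar> * m)"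
      using norm_bop_exp_diff_le[of "\<i> * of_real t" a]
      by (intro mult_left_mono) (simp_all add: norm_mult m_def)
    also have "\<dots> = (exp (\<bar>t\<bar> * m) - 1) / \<bar>t\<bar> - m" using t by (simp add: field_simps)
    finally show "norm ((1 / (\<i> * of_real t)) *\<^sub>C (?u - 1) - a) \<le> (exp (\<bar>t\<bar> * m) - 1) / \<bar>t\<bar> - m" .
  qed
  ultimately have "((\<lambda>t :: real. (1 / (\<i> * of_real t)) *\<^sub>C (bop_exp ((\<i> * of_real t) *\<^sub>C a) - 1) - a) \<longlongrightarrow> 0) (at 0)"
    by (rule Lim_null_comparison[rotated])
  then show ?thesis by (simp only: LIM_zero_iff)
qed

text \<open>The difference from 1 is \<open>\<i> * t\<close> times the difference quotient, whose
  norm converges.\<close>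

lemma tendsto_bop_exp_1:
  fixes a :: "'h :: complex_hilbert bop"
  shows "((\<lambda>t :: real. norm (bop_exp ((\<i> * of_real t) *\<^sub>C a) - 1)) \<longlongrightarrow> 0) (at 0)"
proof (rule tendsto_sandwich[OF _ _ tendsto_const])
  let ?q = "\<lambda>t :: real. (1 / (\<i> * of_real t)) *\<^sub>C (bop_exp ((\<i> * of_real t) *\<^sub>C a) - 1)"
  have "((\<lambda>t. \<bar>t\<bar> * norm (?q t)) \<longlongrightarrow> \<bar>0\<bar> * norm a) (at 0)"
    by (intro tendsto_intros tendsto_bop_exp_difference_quotient)
  then show "((\<lambda>t. \<bar>t\<bar> * norm (?q t)) \<longlongrightarrow> 0) (at 0)" by simp
  have "norm (bop_exp ((\<i> * of_real t) *\<^sub>C a) - 1) \<le> \<bar>t\<bar> * norm (?q t)" if "t \<noteq> 0" for t :: real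
    using norm_scaleC_bop_le[of "\<i> * of_real t" "?q t"] that
    by (simp add: scaleC_scaleC norm_mult)
  then show "\<forall>\<^sub>F t in at 0. norm (bop_exp ((\<i> * of_real t) *\<^sub>C a) - 1) \<le> \<bar>t\<bar> * norm (?q t)"
    by (auto simp: eventually_at intro: exI[of _ 1])
qed simp

lemma eventually_bop_exp_notin:
  fixes a :: "'h :: complex_hilbert bop"
  assumes "von_neumann_algebra M" "a \<notin> M"
  shows "\<forall>\<^sub>F t :: real in at 0. bop_exp ((\<i> * of_real t) *\<^sub>C a) \<notin> M"
proof -
  have M: "M = commutant (commutant M)" by (rule von_neumann_algebraD(2)[OF assms(1)])
  then have "open (- M)" using closed_commutant by (metis open_Compl)
  with tendsto_bop_exp_difference_quotient[of a]
  have *: "\<forall>\<^sub>F t :: real in at 0. (1 / (\<i> * of_real t)) *\<^sub>C (bop_exp ((\<i> * of_real t) *\<^sub>C a) - 1) \<in> - M"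
    by (rule topological_tendstoD) (use assms(2) in simp)
  have "c *\<^sub>C (u - 1) \<in> M" if "u \<in> M" for c u
    by (subst M) (use that M in \<open>auto intro!: commutant_scaleC commutant_diff commutant_one\<close>)
  then show ?thesis by (intro eventually_mono[OF *]) auto
qed


section \<open>Haag duality at a double cone\<close>

text \<open>Up to scale, \<open>b\<close> and \<open>c\<close> are the real and imaginary parts of a
  witness \<open>x\<close> of failure. Since \<open>x\<close> is half of
  \<open>b + \<i> *\<^sub>C c\<close>, they cannot both lie in \<open>A D\<close>.\<close>

lemma dual_net_selfadjoint_notin:
  fixes A :: "(real \<times> 'v :: euclidean_space) set \<Rightarrow> 'h :: complex_hilbert bop set"
  assumes M: "von_neumann_algebra (A D)" and sub: "A D \<subseteq> dual_net A D"
    and fail: "\<not> haag_duality_at A D"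
  obtains a where "adj a = a" "a \<in> dual_net A D - A D"
proof -
  let ?N = "dual_net A D"
  obtain x where x: "x \<in> ?N" "x \<notin> A D" using fail sub by (auto simp: haag_duality_at_def)
  define b where "b = x + adj x"
  define c where "c = \<i> *\<^sub>C (adj x - x)"
  have adjx: "adj x \<in> ?N"
    using x(1) unfolding dual_net_def region_algebra_def
    by (intro commutant_adj) (auto intro: vn_generated_adj)
  have "b \<in> ?N" "c \<in> ?N"
    using x adjx unfolding b_def c_def dual_net_def
    by (auto intro: commutant_add commutant_diff commutant_scaleC)
  moreover have "adj b = b" by (simp add: b_def adj_add add.commute)
  moreover have "adj c = c"
  proof -
    have "adj (adj x - x) = x - adj x"
      using linear_diff[OF bounded_linear.linear[OF bounded_linear_adj], of "adj x" x] by simp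
    moreover have "(- \<i>) *\<^sub>C (x - adj x) = \<i> *\<^sub>C (adj x - x)"
      by (simp add: scaleC_minus_left flip: scaleC_minus_right)
    ultimately show ?thesis by (simp add: c_def adj_scaleC)
  qed
  moreover have "b \<notin> A D \<or> c \<notin> A D"
  proof (rule ccontr)
    assume "\<not> (b \<notin> A D \<or> c \<notin> A D)"
    then have "(1 / 2) *\<^sub>C (b + \<i> *\<^sub>C c) \<in> commutant (commutant (A D))"
      using von_neumann_algebraD(2)[OF M] by (auto intro!: commutant_scaleC commutant_add)
    moreover have "(1 / 2) *\<^sub>C (b + \<i> *\<^sub>C c) = x"
    proof -
      have "b + \<i> *\<^sub>C c = x + x"
        by (simp add: b_def c_def scaleC_scaleC scaleC_minus_left)
      then show ?thesis by (simp add: scaleC_add_right flip: scaleC_add_left)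
    qed
    ultimately show False using x(2) von_neumann_algebraD(2)[OF M] by simp
  qed
  ultimately show ?thesis using that by blast
qed

theorem theorem3p2:
  fixes A :: "(real \<times> 'v :: euclidean_space) set \<Rightarrow> 'h :: complex_hilbert bop set"
    and D :: "(real \<times> 'v) set"
  assumes "haag_kastler_net A" and "double_cone D"
  shows
    "(haag_duality_at A D \<longleftrightarrow>
        (\<forall>\<Phi>. normal_ucp \<Phi> \<and> (\<forall>y\<in>region_algebra A (causal_complement D). \<Phi> y = y)
          \<longrightarrow> inner_channel (A D) \<Phi>)) \<and>
     (haag_duality_at A D \<longleftrightarrow> NS A D = Chan (A D)) \<and>
     (\<not> haag_duality_at A D \<longrightarrow>
        (\<forall>a. adj a = a \<and> a \<in> dual_net A D - A D \<longrightarrow>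
          (\<exists>\<delta>>0. \<forall>t :: real. 0 < \<bar>t\<bar> \<and> \<bar>t\<bar> < \<delta> \<longrightarrow>
            Ad (bop_exp ((\<i> * complex_of_real t) *\<^sub>C a)) \<in> NS A D - Chan (A D)) \<and>
          ((\<lambda>t :: real. cb_norm (\<lambda>x. Ad (bop_exp ((\<i> * complex_of_real t) *\<^sub>C a)) x - x))
            \<longlongrightarrow> 0) (at 0)))"
proof -
  define R where "R = region_algebra A (causal_complement D)"
  define U where "U a t = bop_exp ((\<i> * complex_of_real t) *\<^sub>C a)" for a :: "'h bop" and t :: real
  have M: "von_neumann_algebra (A D)"
    using assms by (simp add: haag_kastler_net_def)
  have dual: "dual_net A D = commutant R" by (simp add: dual_net_def R_def)
  have R_sub: "R \<subseteq> commutant (A D)"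
    unfolding R_def region_algebra_def
  proof (rule vn_generated_subset_commutant)
    show "adj ` A D \<subseteq> A D" using von_neumann_algebraD(1)[OF M] by blast
    show "(\<Union>E\<in>{E. double_cone E \<and> E \<subseteq> causal_complement D}. A E) \<subseteq> commutant (A D)"
      using assms unfolding haag_kastler_net_def commutant_def by blast
  qed
  then have sub: "A D \<subseteq> dual_net A D" by (auto simp: dual commutant_def)
  have Chan_NS: "Chan (A D) \<subseteq> NS A D"
  proof
    fix \<Phi> assume "\<Phi> \<in> Chan (A D)"
    then have "inner_channel (A D) \<Phi>" by (simp add: Chan_def)
    moreover from this have "normal_ucp \<Phi>" by (simp add: inner_channel_def)
    ultimately show "\<Phi> \<in> NS A D"
      using inner_channel_fixes_commutant[of "A D" \<Phi>] R_sub by (auto simp: NS_def R_def)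
  qed
  \<comment> \<open>The Kraus operators are first located in the commutant of \<open>R\<close>, that
    is in the dual net; duality then identifies it with \<open>A D\<close>.\<close>
  have NS_inner: "inner_channel (dual_net A D) \<Phi>" if "\<Phi> \<in> NS A D" for \<Phi>
    unfolding dual
    by (rule inner_channel_commutant)
       (use that in \<open>auto simp: NS_def R_def region_algebra_def
         intro: vn_generated_adj vn_generated_times\<close>)
  have U_NS: "Ad (U a t) \<in> NS A D" if a: "adj a = a" "a \<in> dual_net A D" for a t
    using normal_ucp_Ad[OF bop_exp_unitary(1)[OF a(1)]]
      Ad_fixes[OF bop_exp_unitary(1)[OF a(1)] bop_exp_commutant[of a R]] a(2)
    by (auto simp: NS_def U_def R_def dual)
  have U_Chan: "\<forall>\<^sub>F t in at 0. Ad (U a t) \<notin> Chan (A D)" if a: "adj a = a" "a \<notin> A D" for a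
    using eventually_bop_exp_notin[OF M a(2)]
    by eventually_elim
       (use inner_channel_AdD[OF M bop_exp_unitary(2)[OF a(1)]] in \<open>auto simp: U_def Chan_def\<close>)
  have separate: "\<exists>\<delta>>0. \<forall>t. 0 < \<bar>t\<bar> \<and> \<bar>t\<bar> < \<delta> \<longrightarrow> Ad (U a t) \<in> NS A D - Chan (A D)"
    if a: "adj a = a" "a \<in> dual_net A D - A D" for a
  proof -
    obtain \<delta> where "\<delta> > 0" "\<And>t. t \<noteq> 0 \<Longrightarrow> \<bar>t\<bar> < \<delta> \<Longrightarrow> Ad (U a t) \<notin> Chan (A D)"
      using U_Chan[of a] a by (auto simp: eventually_at dist_real_def)
    then show ?thesis using U_NS[of a] a by (intro exI[of _ \<delta>]) auto
  qed
  have lim: "((\<lambda>t. cb_norm (\<lambda>x. Ad (U a t) x - x)) \<longlongrightarrow> 0) (at 0)" if a: "adj a = a" for a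
  proof (rule tendsto_sandwich[OF _ _ tendsto_const])
    show "\<forall>\<^sub>F t in at 0. cb_norm (\<lambda>x. Ad (U a t) x - x) \<le> ennreal (2 * norm (U a t - 1))"
      unfolding U_def by (intro always_eventually allI cb_norm_Ad_diff_le bop_exp_unitary(1)[OF a])
    have "((\<lambda>t. ennreal (2 * norm (U a t - 1))) \<longlongrightarrow> ennreal (2 * 0)) (at 0)"
      unfolding U_def by (intro tendsto_ennrealI tendsto_intros tendsto_bop_exp_1)
    then show "((\<lambda>t. ennreal (2 * norm (U a t - 1))) \<longlongrightarrow> 0) (at 0)" by simp
  qed simp
  have duality: "haag_duality_at A D \<longleftrightarrow> NS A D = Chan (A D)"
  proof
    assume "haag_duality_at A D"
    then show "NS A D = Chan (A D)"
      using NS_inner Chan_NS by (auto simp: haag_duality_at_def Chan_def)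
  next
    assume eq: "NS A D = Chan (A D)"
    show "haag_duality_at A D"
    proof (rule ccontr)
      assume "\<not> haag_duality_at A D"
      then obtain a where "adj a = a" "a \<in> dual_net A D - A D"
        using dual_net_selfadjoint_notin[OF M sub] by blast
      from separate[OF this] obtain \<delta> where "\<delta> > 0"
        "\<forall>t. 0 < \<bar>t\<bar> \<and> \<bar>t\<bar> < \<delta> \<longrightarrow> Ad (U a t) \<in> NS A D - Chan (A D)"
        by blast
      then have "Ad (U a (\<delta> / 2)) \<in> NS A D - Chan (A D)" by simp
      with eq show False by simp
    qed
  qed
  have NS_iff: "NS A D = Chan (A D) \<longleftrightarrow>
      (\<forall>\<Phi>. normal_ucp \<Phi> \<and> (\<forall>y\<in>region_algebra A (causal_complement D). \<Phi> y = y)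
        \<longrightarrow> inner_channel (A D) \<Phi>)"
    using Chan_NS by (auto simp: NS_def Chan_def)
  show ?thesis
  proof (intro conjI impI allI)
    show "haag_duality_at A D \<longleftrightarrow> NS A D = Chan (A D)" by (rule duality)
    show "haag_duality_at A D \<longleftrightarrow>
        (\<forall>\<Phi>. normal_ucp \<Phi> \<and> (\<forall>y\<in>region_algebra A (causal_complement D). \<Phi> y = y)
          \<longrightarrow> inner_channel (A D) \<Phi>)"
      unfolding duality by (rule NS_iff)
    fix a :: "'h bop" assume a: "adj a = a \<and> a \<in> dual_net A D - A D"
    then have a': "adj a = a" "a \<in> dual_net A D - A D" by blast+
    show "\<exists>\<delta>>0. \<forall>t :: real. 0 < \<bar>t\<bar> \<and> \<bar>t\<bar> < \<delta> \<longrightarrow>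
        Ad (bop_exp ((\<i> * complex_of_real t) *\<^sub>C a)) \<in> NS A D - Chan (A D)"
      using separate[OF a'] unfolding U_def .
    show "((\<lambda>t :: real. cb_norm (\<lambda>x. Ad (bop_exp ((\<i> * complex_of_real t) *\<^sub>C a)) x - x)) \<longlongrightarrow> 0) (at 0)"
      using lim[OF a'(1)] unfolding U_def .
  qed
qed

end
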